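(* Let $\mathscr{A}$ be an Abelian category endowed with a shift functor, let $\mathbb{V}=(V,F)$ be an object of $\mathscr{AF}$ of type $[-r,r]$ for some $r\ge0$, and let $e:\mathbb{V}\to\mathbb{V}[2](1)$ be an arrow in $\mathscr{AF}$ such that for every $k\ge0$ the induced arrow $e^k:V_{-k}\to V_k(k)$ is an isomorphism in $\mathscr{A}$. Then there is a good splitting $$\omega_{\rm I}(e):\ \mathbb{V}_*=\bigoplus_{p\in[-r,r]}\mathbb{V}_p\ \xrightarrow{\ \cong\ }\ \mathbb{V}$$ in $\mathscr{AF}$.
   Context: The shift functor $(1):\mathscr{A}\to\mathscr{A}$ is an additive exact autoequivalence, with iterates $(m)$, $m\in\mathbb{Z}$. $\mathscr{AF}$ is the category of pairs $\mathbb{V}=(V,F)$ with $V\in\mathscr{A}$ and $F$ a finite increasing filtration of $V$ by subobjects ($F_pV=0$ for $p\ll0$, $F_pV=V$ for $p\gg0$); arrows are the arrows of $\mathscr{A}$ mapping $F_p$ to $F_p$ for all $p$. The translate is $F[n]_pV:=F_{n+p}V$; $\mathbb{V}[n]:=(V,F[n])$ and $\mathbb{V}(m):=(V(m),F)$ with $F_p(V(m))=(F_pV)(m)$. Put $V_p:=F_pV/F_{p-1}V$ and let $\mathbb{V}_p$ be $V_p$ with the trivial filtration placed in position $p$ (i.e. $F_{p-1}=0$, $F_p=V_p$). $\mathbb{V}$ has type $[a,b]$ if $V_p=0$ for every $p\notin[a,b]$. The arrow $e$ induces $V_p\to V_{p+2}(1)$, and its $k$-th iterate $e^k:\mathbb{V}\to\mathbb{V}[2k](k)$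 induces $V_p\to V_{p+2k}(k)$. A splitting of $\mathbb{V}$ is an isomorphism $\varphi:\mathbb{V}_*\cong\mathbb{V}$ in $\mathscr{AF}$; it is good if for every $p$ the induced map $V_p\to V_p$ on $p$-th graded pieces is the identity. *)

theory Defs
  imports "HOL-Algebra.FiniteProduct"
begin

section \<open>Preadditive and abelian categories\<close>

text \<open>
  A category is given by a set of objects and, for any two objects, a set of arrows, all arrows
  living in one type. Hom-sets are not required to be disjoint, so every notion below carries the
  source and the target of the arrows it speaks about; this lets filtered objects form a category
  whose arrows literally are arrows of the underlying category. \<open>Add\<close> and \<open>Zero\<close> are the
  addition and the zero arrows of a preadditive structure.
\<close>

record ('o, 'm) cat =
  Ob :: "'o set"
  Hom :: "'o \<Rightarrow> 'o \<Rightarrow> 'm set"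
  Idn :: "'o \<Rightarrow> 'm"
  Comp :: "'m \<Rightarrow> 'm \<Rightarrow> 'm"  (infixl "\<cdot>\<index>" 70)
  Add :: "'m \<Rightarrow> 'm \<Rightarrow> 'm"
  Zero :: "'o \<Rightarrow> 'o \<Rightarrow> 'm"

text \<open>The additive group of arrows, as a (multiplicatively written) group of \<open>HOL-Algebra\<close>.\<close>

definition hom_grp :: "('o, 'm) cat \<Rightarrow> 'o \<Rightarrow> 'o \<Rightarrow> 'm monoid" where
  "hom_grp C X Y = \<lparr>carrier = Hom C X Y, mult = Add C, one = Zero C X Y\<rparr>"

locale category =
  fixes C :: "('o, 'm) cat" (structure)
  assumes Idn_in_Hom: "X \<in> Ob C \<Longrightarrow> Idn C X \<in> Hom C X X"
    and Comp_in_Hom: "\<lbrakk>X \<in> Ob C; Y \<in> Ob C; Z \<in> Ob C; f \<in> Hom C X Y; g \<in> Hom C Y Z\<rbrakk>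
      \<Longrightarrow> g \<cdot> f \<in> Hom C X Z"
    and Comp_Idn: "\<lbrakk>X \<in> Ob C; Y \<in> Ob C; f \<in> Hom C X Y\<rbrakk> \<Longrightarrow> f \<cdot> Idn C X = f"
    and Idn_Comp: "\<lbrakk>X \<in> Ob C; Y \<in> Ob C; f \<in> Hom C X Y\<rbrakk> \<Longrightarrow> Idn C Y \<cdot> f = f"
    and Comp_assoc: "\<lbrakk>W \<in> Ob C; X \<in> Ob C; Y \<in> Ob C; Z \<in> Ob C;
      f \<in> Hom C W X; g \<in> Hom C X Y; h \<in> Hom C Y Z\<rbrakk> \<Longrightarrow> (h \<cdot> g) \<cdot> f = h \<cdot> (g \<cdot> f)"

locale preadditive_category = category +
  assumes comm_group_Hom: "\<lbrakk>X \<in> Ob C; Y \<in> Ob C\<rbrakk> \<Longrightarrow> comm_group (hom_grp C X Y)"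
    and Comp_Add: "\<lbrakk>X \<in> Ob C; Y \<in> Ob C; Z \<in> Ob C; f \<in> Hom C X Y; g \<in> Hom C X Y; h \<in> Hom C Y Z\<rbrakk>
      \<Longrightarrow> h \<cdot> Add C f g = Add C (h \<cdot> f) (h \<cdot> g)"
    and Add_Comp: "\<lbrakk>X \<in> Ob C; Y \<in> Ob C; Z \<in> Ob C; f \<in> Hom C X Y; g \<in> Hom C Y Z; h \<in> Hom C Y Z\<rbrakk>
      \<Longrightarrow> Add C g h \<cdot> f = Add C (g \<cdot> f) (h \<cdot> f)"

definition monic :: "('o, 'm) cat \<Rightarrow> 'o \<Rightarrow> 'o \<Rightarrow> 'm \<Rightarrow> bool" where
  "monic C X Y f \<longleftrightarrow> f \<in> Hom C X Y \<and>
    (\<forall>Z\<in>Ob C. \<forall>u\<in>Hom C Z X. \<forall>v\<in>Hom C Z X. f \<cdot>\<^bsub>C\<^esub> u = f \<cdot>\<^bsub>C\<^esub> v \<longrightarrow> u = v)"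

definition epic :: "('o, 'm) cat \<Rightarrow> 'o \<Rightarrow> 'o \<Rightarrow> 'm \<Rightarrow> bool" where
  "epic C X Y f \<longleftrightarrow> f \<in> Hom C X Y \<and>
    (\<forall>Z\<in>Ob C. \<forall>u\<in>Hom C Y Z. \<forall>v\<in>Hom C Y Z. u \<cdot>\<^bsub>C\<^esub> f = v \<cdot>\<^bsub>C\<^esub> f \<longrightarrow> u = v)"

definition iso_arrow :: "('o, 'm) cat \<Rightarrow> 'o \<Rightarrow> 'o \<Rightarrow> 'm \<Rightarrow> bool" where
  "iso_arrow C X Y f \<longleftrightarrow> f \<in> Hom C X Y \<and>
    (\<exists>g\<in>Hom C Y X. g \<cdot>\<^bsub>C\<^esub> f = Idn C X \<and> f \<cdot>\<^bsub>C\<^esub> g = Idn C Y)"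

definition zero_object :: "('o, 'm) cat \<Rightarrow> 'o \<Rightarrow> bool" where
  "zero_object C Z \<longleftrightarrow> Z \<in> Ob C \<and>
    (\<forall>X\<in>Ob C. (\<exists>!f. f \<in> Hom C Z X) \<and> (\<exists>!f. f \<in> Hom C X Z))"

text \<open>\<open>is_kernel C X Y f K k\<close>: the arrow \<open>k : K \<rightarrow> X\<close> is a kernel of \<open>f : X \<rightarrow> Y\<close>.\<close>

definition is_kernel :: "('o, 'm) cat \<Rightarrow> 'o \<Rightarrow> 'o \<Rightarrow> 'm \<Rightarrow> 'o \<Rightarrow> 'm \<Rightarrow> bool" where
  "is_kernel C X Y f K k \<longleftrightarrow> K \<in> Ob C \<and> k \<in> Hom C K X \<and> f \<cdot>\<^bsub>C\<^esub> k = Zero C K Y \<and>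
    (\<forall>Z\<in>Ob C. \<forall>u\<in>Hom C Z X. f \<cdot>\<^bsub>C\<^esub> u = Zero C Z Y \<longrightarrow> (\<exists>!v. v \<in> Hom C Z K \<and> k \<cdot>\<^bsub>C\<^esub> v = u))"

text \<open>\<open>is_cokernel C X Y f Q q\<close>: the arrow \<open>q : Y \<rightarrow> Q\<close> is a cokernel of \<open>f : X \<rightarrow> Y\<close>.\<close>

definition is_cokernel :: "('o, 'm) cat \<Rightarrow> 'o \<Rightarrow> 'o \<Rightarrow> 'm \<Rightarrow> 'o \<Rightarrow> 'm \<Rightarrow> bool" where
  "is_cokernel C X Y f Q q \<longleftrightarrow> Q \<in> Ob C \<and> q \<in> Hom C Y Q \<and> q \<cdot>\<^bsub>C\<^esub> f = Zero C X Q \<and>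
    (\<forall>Z\<in>Ob C. \<forall>u\<in>Hom C Y Z. u \<cdot>\<^bsub>C\<^esub> f = Zero C X Z \<longrightarrow> (\<exists>!v. v \<in> Hom C Q Z \<and> v \<cdot>\<^bsub>C\<^esub> q = u))"

text \<open>
  \<open>W\<close> is the direct sum (biproduct) of the finite family \<open>X i\<close>, \<open>i \<in> I\<close>, with injections \<open>\<iota>\<close>
  and projections \<open>\<pi>\<close>; the product in \<open>hom_grp\<close> is the sum of the arrows \<open>\<iota> i \<cdot> \<pi> i\<close>.
\<close>

definition direct_sum ::
  "('o, 'm) cat \<Rightarrow> 'i set \<Rightarrow> ('i \<Rightarrow> 'o) \<Rightarrow> 'o \<Rightarrow> ('i \<Rightarrow> 'm) \<Rightarrow> ('i \<Rightarrow> 'm) \<Rightarrow> bool" where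
  "direct_sum C I X W \<iota> \<pi> \<longleftrightarrow> finite I \<and> W \<in> Ob C \<and>
    (\<forall>i\<in>I. X i \<in> Ob C \<and> \<iota> i \<in> Hom C (X i) W \<and> \<pi> i \<in> Hom C W (X i)) \<and>
    (\<forall>i\<in>I. \<forall>j\<in>I. \<pi> j \<cdot>\<^bsub>C\<^esub> \<iota> i = (if i = j then Idn C (X i) else Zero C (X i) (X j))) \<and>
    finprod (hom_grp C W W) (\<lambda>i. \<iota> i \<cdot>\<^bsub>C\<^esub> \<pi> i) I = Idn C W"

locale abelian_category = preadditive_category +
  assumes zero_object_exists: "\<exists>Z. zero_object C Z"
    and direct_sum_exists: "\<lbrakk>X \<in> Ob C; Y \<in> Ob C\<rbrakk>
      \<Longrightarrow> \<exists>W \<iota> \<pi>. direct_sum C (UNIV :: bool set) (\<lambda>b. if b then X else Y) W \<iota> \<pi>"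
    and kernel_exists: "\<lbrakk>X \<in> Ob C; Y \<in> Ob C; f \<in> Hom C X Y\<rbrakk> \<Longrightarrow> \<exists>K k. is_kernel C X Y f K k"
    and cokernel_exists: "\<lbrakk>X \<in> Ob C; Y \<in> Ob C; f \<in> Hom C X Y\<rbrakk> \<Longrightarrow> \<exists>Q q. is_cokernel C X Y f Q q"
    and monic_is_kernel: "\<lbrakk>X \<in> Ob C; Y \<in> Ob C; monic C X Y f\<rbrakk>
      \<Longrightarrow> \<exists>Z\<in>Ob C. \<exists>g\<in>Hom C Y Z. is_kernel C Y Z g X f"
    and epic_is_cokernel: "\<lbrakk>X \<in> Ob C; Y \<in> Ob C; epic C X Y f\<rbrakk>
      \<Longrightarrow> \<exists>Z\<in>Ob C. \<exists>g\<in>Hom C Z X. is_cokernel C Z X g Y f"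

definition short_exact :: "('o, 'm) cat \<Rightarrow> 'o \<Rightarrow> 'o \<Rightarrow> 'o \<Rightarrow> 'm \<Rightarrow> 'm \<Rightarrow> bool" where
  "short_exact C X Y Z f g \<longleftrightarrow> X \<in> Ob C \<and> Y \<in> Ob C \<and> Z \<in> Ob C \<and>
    is_kernel C Y Z g X f \<and> is_cokernel C X Y f Z g"


section \<open>Shift functors\<close>

record ('o, 'm) functor_data =
  FOb :: "'o \<Rightarrow> 'o"
  FHom :: "'m \<Rightarrow> 'm"

definition id_functor :: "('o, 'm) functor_data" where
  "id_functor = \<lparr>FOb = id, FHom = id\<rparr>"

definition comp_functor :: "('o, 'm) functor_data \<Rightarrow> ('o, 'm) functor_data \<Rightarrow> ('o, 'm) functor_data" where
  "comp_functor S T = \<lparr>FOb = FOb S \<circ> FOb T, FHom = FHom S \<circ> FHom T\<rparr>"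

definition iterate_functor :: "('o, 'm) functor_data \<Rightarrow> nat \<Rightarrow> ('o, 'm) functor_data" where
  "iterate_functor T k = \<lparr>FOb = FOb T ^^ k, FHom = FHom T ^^ k\<rparr>"

definition endofunctor :: "('o, 'm) cat \<Rightarrow> ('o, 'm) functor_data \<Rightarrow> bool" where
  "endofunctor C T \<longleftrightarrow>
    (\<forall>X\<in>Ob C. FOb T X \<in> Ob C \<and> FHom T (Idn C X) = Idn C (FOb T X)) \<and>
    (\<forall>X\<in>Ob C. \<forall>Y\<in>Ob C. \<forall>f\<in>Hom C X Y. FHom T f \<in> Hom C (FOb T X) (FOb T Y)) \<and>
    (\<forall>X\<in>Ob C. \<forall>Y\<in>Ob C. \<forall>Z\<in>Ob C. \<forall>f\<in>Hom C X Y. \<forall>g\<in>Hom C Y Z.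
      FHom T (g \<cdot>\<^bsub>C\<^esub> f) = FHom T g \<cdot>\<^bsub>C\<^esub> FHom T f)"

definition natural_iso ::
  "('o, 'm) cat \<Rightarrow> ('o, 'm) functor_data \<Rightarrow> ('o, 'm) functor_data \<Rightarrow> ('o \<Rightarrow> 'm) \<Rightarrow> bool" where
  "natural_iso C S T \<eta> \<longleftrightarrow>
    (\<forall>X\<in>Ob C. iso_arrow C (FOb S X) (FOb T X) (\<eta> X)) \<and>
    (\<forall>X\<in>Ob C. \<forall>Y\<in>Ob C. \<forall>f\<in>Hom C X Y. \<eta> Y \<cdot>\<^bsub>C\<^esub> FHom S f = FHom T f \<cdot>\<^bsub>C\<^esub> \<eta> X)"

definition autoequivalence :: "('o, 'm) cat \<Rightarrow> ('o, 'm) functor_data \<Rightarrow> bool" where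
  "autoequivalence C T \<longleftrightarrow> endofunctor C T \<and>
    (\<exists>S. endofunctor C S \<and> (\<exists>\<eta>. natural_iso C id_functor (comp_functor S T) \<eta>) \<and>
      (\<exists>\<epsilon>. natural_iso C (comp_functor T S) id_functor \<epsilon>))"

definition additive_functor :: "('o, 'm) cat \<Rightarrow> ('o, 'm) functor_data \<Rightarrow> bool" where
  "additive_functor C T \<longleftrightarrow>
    (\<forall>X\<in>Ob C. \<forall>Y\<in>Ob C. FHom T \<in> hom (hom_grp C X Y) (hom_grp C (FOb T X) (FOb T Y)))"

definition exact_functor :: "('o, 'm) cat \<Rightarrow> ('o, 'm) functor_data \<Rightarrow> bool" where
  "exact_functor C T \<longleftrightarrow> (\<forall>X Y Z f g. short_exact C X Y Z f g \<longrightarrow>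
    short_exact C (FOb T X) (FOb T Y) (FOb T Z) (FHom T f) (FHom T g))"

definition shift_functor :: "('o, 'm) cat \<Rightarrow> ('o, 'm) functor_data \<Rightarrow> bool" where
  "shift_functor C T \<longleftrightarrow> autoequivalence C T \<and> additive_functor C T \<and> exact_functor C T"


section \<open>The category of filtered objects\<close>

text \<open>The subobject \<open>F p\<close> of \<open>V\<close> is represented by a monomorphism \<open>Inc p : Fil p \<rightarrow> Tot\<close>.\<close>

record ('o, 'm) filtered =
  Tot :: 'o
  Fil :: "int \<Rightarrow> 'o"
  Inc :: "int \<Rightarrow> 'm"

definition filtered_object :: "('o, 'm) cat \<Rightarrow> ('o, 'm) filtered \<Rightarrow> bool" where
  "filtered_object A V \<longleftrightarrow> Tot V \<in> Ob A \<and>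
    (\<forall>p. Fil V p \<in> Ob A \<and> monic A (Fil V p) (Tot V) (Inc V p)) \<and>
    (\<forall>p. \<exists>j\<in>Hom A (Fil V (p - 1)) (Fil V p). Inc V p \<cdot>\<^bsub>A\<^esub> j = Inc V (p - 1)) \<and>
    (\<exists>a. \<forall>p\<le>a. zero_object A (Fil V p)) \<and>
    (\<exists>b. \<forall>p\<ge>b. iso_arrow A (Fil V p) (Tot V) (Inc V p))"

definition AF :: "('o, 'm) cat \<Rightarrow> (('o, 'm) filtered, 'm) cat" where
  "AF A = \<lparr>
    Ob = {V. filtered_object A V},
    Hom = \<lambda>V W. {f \<in> Hom A (Tot V) (Tot W).
      \<forall>p. \<exists>g\<in>Hom A (Fil V p) (Fil W p). Inc W p \<cdot>\<^bsub>A\<^esub> g = f \<cdot>\<^bsub>A\<^esub> Inc V p},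
    Idn = \<lambda>V. Idn A (Tot V),
    Comp = Comp A,
    Add = Add A,
    Zero = \<lambda>V W. Zero A (Tot V) (Tot W)\<rparr>"

text \<open>The arrow \<open>Fil V p \<rightarrow> Fil W p\<close> obtained by restricting an arrow \<open>f : V \<rightarrow> W\<close> of \<open>AF A\<close>.\<close>

definition restr ::
  "('o, 'm) cat \<Rightarrow> ('o, 'm) filtered \<Rightarrow> ('o, 'm) filtered \<Rightarrow> 'm \<Rightarrow> int \<Rightarrow> 'm" where
  "restr A V W f p =
    (THE g. g \<in> Hom A (Fil V p) (Fil W p) \<and> Inc W p \<cdot>\<^bsub>A\<^esub> g = f \<cdot>\<^bsub>A\<^esub> Inc V p)"

text \<open>The inclusion of \<open>Fil V (p - 1)\<close> into \<open>Fil V p\<close>.\<close>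

definition step :: "('o, 'm) cat \<Rightarrow> ('o, 'm) filtered \<Rightarrow> int \<Rightarrow> 'm" where
  "step A V p =
    (THE j. j \<in> Hom A (Fil V (p - 1)) (Fil V p) \<and> Inc V p \<cdot>\<^bsub>A\<^esub> j = Inc V (p - 1))"

definition translate :: "('o, 'm) filtered \<Rightarrow> int \<Rightarrow> ('o, 'm) filtered" where
  "translate V n = \<lparr>Tot = Tot V, Fil = (\<lambda>p. Fil V (n + p)), Inc = (\<lambda>p. Inc V (n + p))\<rparr>"

text \<open>\<open>twist T V m\<close> is \<open>V(m)\<close>, where \<open>T\<close> is the shift functor \<open>(1)\<close>.\<close>

definition twist :: "('o, 'm) functor_data \<Rightarrow> ('o, 'm) filtered \<Rightarrow> nat \<Rightarrow> ('o, 'm) filtered" where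
  "twist T V m = \<lparr>
    Tot = FOb (iterate_functor T m) (Tot V),
    Fil = (\<lambda>p. FOb (iterate_functor T m) (Fil V p)),
    Inc = (\<lambda>p. FHom (iterate_functor T m) (Inc V p))\<rparr>"

text \<open>
  The graded piece \<open>gr A V p\<close> and the quotient arrow \<open>gr_proj A V p : Fil V p \<rightarrow> gr A V p\<close>:
  a fixed choice of a cokernel of \<open>step A V p\<close>.
\<close>

definition gr_quot :: "('o, 'm) cat \<Rightarrow> ('o, 'm) filtered \<Rightarrow> int \<Rightarrow> 'o \<times> 'm" where
  "gr_quot A V p = (SOME (Q, q). is_cokernel A (Fil V (p - 1)) (Fil V p) (step A V p) Q q)"

definition gr :: "('o, 'm) cat \<Rightarrow> ('o, 'm) filtered \<Rightarrow> int \<Rightarrow> 'o" where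
  "gr A V p = fst (gr_quot A V p)"

definition gr_proj :: "('o, 'm) cat \<Rightarrow> ('o, 'm) filtered \<Rightarrow> int \<Rightarrow> 'm" where
  "gr_proj A V p = snd (gr_quot A V p)"

definition has_type :: "('o, 'm) cat \<Rightarrow> ('o, 'm) filtered \<Rightarrow> int \<Rightarrow> int \<Rightarrow> bool" where
  "has_type A V a b \<longleftrightarrow> (\<forall>p. p \<notin> {a..b} \<longrightarrow> zero_object A (gr A V p))"

definition zero_ob :: "('o, 'm) cat \<Rightarrow> 'o" where
  "zero_ob A = (SOME Z. zero_object A Z)"

text \<open>The object \<open>X\<close> with the trivial filtration placed in position \<open>p\<close>.\<close>

definition placed :: "('o, 'm) cat \<Rightarrow> 'o \<Rightarrow> int \<Rightarrow> ('o, 'm) filtered" where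
  "placed A X p = \<lparr>
    Tot = X,
    Fil = (\<lambda>i. if i < p then zero_ob A else X),
    Inc = (\<lambda>i. if i < p then Zero A (zero_ob A) X else Idn A X)\<rparr>"


section \<open>Induced arrows and splittings\<close>

text \<open>
  The factorization through a quotient arrow \<open>q : X \<rightarrow> P\<close> of an arrow \<open>h : X \<rightarrow> Q\<close>.
\<close>

definition descend :: "('o, 'm) cat \<Rightarrow> 'o \<Rightarrow> 'o \<Rightarrow> 'm \<Rightarrow> 'm \<Rightarrow> 'm" where
  "descend A P Q q h = (THE g. g \<in> Hom A P Q \<and> g \<cdot>\<^bsub>A\<^esub> q = h)"

text \<open>The iterate \<open>e\<^sup>k : V \<rightarrow> V[2k](k)\<close> of \<open>e : V \<rightarrow> V[2](1)\<close>, as an arrow of \<open>A\<close>.\<close>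

primrec arrow_power ::
  "('o, 'm) cat \<Rightarrow> ('o, 'm) functor_data \<Rightarrow> ('o, 'm) filtered \<Rightarrow> 'm \<Rightarrow> nat \<Rightarrow> 'm" where
  "arrow_power A T V e 0 = Idn A (Tot V)"
| "arrow_power A T V e (Suc k) = FHom (iterate_functor T k) e \<cdot>\<^bsub>A\<^esub> arrow_power A T V e k"

text \<open>
  The arrow \<open>gr A V p \<rightarrow> (gr A V (p + 2k))(k)\<close> induced by \<open>e\<^sup>k\<close>. As the shift functor is exact,
  the \<open>p\<close>-th graded piece of \<open>V[2k](k)\<close> is \<open>(gr A V (p + 2k))(k)\<close>, with quotient arrow the
  \<open>k\<close>-th shift of that of \<open>V\<close>.
\<close>

definition gr_power ::
  "('o, 'm) cat \<Rightarrow> ('o, 'm) functor_data \<Rightarrow> ('o, 'm) filtered \<Rightarrow> 'm \<Rightarrow> nat \<Rightarrow> int \<Rightarrow> 'm" where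
  "gr_power A T V e k p =
    descend A (gr A V p) (FOb (iterate_functor T k) (gr A V (p + 2 * int k))) (gr_proj A V p)
      (FHom (iterate_functor T k) (gr_proj A V (p + 2 * int k)) \<cdot>\<^bsub>A\<^esub>
        restr A V (twist T (translate V (2 * int k)) k) (arrow_power A T V e k) p)"

text \<open>
  \<open>(W, \<iota>, \<pi>)\<close> is the filtered object \<open>V\<^sub>* = \<Oplus>\<^sub>p V\<^sub>p\<close>, the sum being taken in \<open>AF A\<close> over
  \<open>p \<in> [a, b]\<close>.
\<close>

definition is_graded_sum ::
  "('o, 'm) cat \<Rightarrow> ('o, 'm) filtered \<Rightarrow> int \<Rightarrow> int \<Rightarrow>
    ('o, 'm) filtered \<Rightarrow> (int \<Rightarrow> 'm) \<Rightarrow> (int \<Rightarrow> 'm) \<Rightarrow> bool" where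
  "is_graded_sum A V a b W \<iota> \<pi> \<longleftrightarrow>
    direct_sum (AF A) {a..b} (\<lambda>p. placed A (gr A V p) p) W \<iota> \<pi>"

definition splitting ::
  "('o, 'm) cat \<Rightarrow> ('o, 'm) filtered \<Rightarrow> ('o, 'm) filtered \<Rightarrow> 'm \<Rightarrow> bool" where
  "splitting A V W \<phi> \<longleftrightarrow> iso_arrow (AF A) W V \<phi>"

text \<open>
  The \<open>p\<close>-th graded piece of \<open>W = V\<^sub>*\<close> is \<open>gr A V p\<close>, with quotient arrow the restriction
  \<open>\<pi> p \<cdot> Inc W p\<close> of the projection to \<open>Fil W p\<close>. For \<open>p\<close> outside \<open>[a, b]\<close> the graded pieces
  vanish and there is no condition.
\<close>

definition good_splitting ::
  "('o, 'm) cat \<Rightarrow> ('o, 'm) filtered \<Rightarrow> int \<Rightarrow> int \<Rightarrow>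
    ('o, 'm) filtered \<Rightarrow> (int \<Rightarrow> 'm) \<Rightarrow> 'm \<Rightarrow> bool" where
  "good_splitting A V a b W \<pi> \<phi> \<longleftrightarrow> splitting A V W \<phi> \<and>
    (\<forall>p\<in>{a..b}. descend A (gr A V p) (gr A V p) (\<pi> p \<cdot>\<^bsub>A\<^esub> Inc W p)
      (gr_proj A V p \<cdot>\<^bsub>A\<^esub> restr A W V \<phi> p) = Idn A (gr A V p))"

end

theory Submission
  imports Defs
begin

text \<open>
  A good splitting of \<open>V\<close> amounts to splitting the quotient \<open>Fil V p \<rightarrow> gr A V p\<close> for every \<open>p\<close>: from
  sections \<open>s p\<close> of these, \<open>V\<close> becomes a direct sum of its graded pieces in the category of filtered
  objects (\<open>graded_sum_of_sections\<close>). Hence a graded sum exists, namely \<open>V\<close> itself, and any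
  other one is isomorphic to it by an isomorphism compatible with the projections, which is good
  (\<open>good_splitting_of_graded_sums\<close>).

  The sections come from the isomorphisms \<open>e\<^sup>k : V\<^sub>-\<^sub>k \<cong> V\<^sub>k(k)\<close> by splitting the filtration from its two
  ends towards the middle (\<open>lefschetz_step\<close>). Suppose that \<open>V\<close> retracts onto \<open>F\<^sub>-\<^sub>k\<^sub>-\<^sub>1\<close> by \<open>\<rho>\<close> and onto
  \<open>F\<^sub>k\<close> by \<open>\<sigma>\<close>. The restriction of \<open>\<rho>\<close> to \<open>F\<^sub>-\<^sub>k\<close> gives a section of \<open>F\<^sub>-\<^sub>k \<rightarrow> V\<^sub>-\<^sub>k\<close>. The composite
  \<open>V\<^sub>k(k) \<cong> V\<^sub>-\<^sub>k \<rightarrow> F\<^sub>-\<^sub>k \<rightarrow> F\<^sub>k(k)\<close>, with last arrow \<open>e\<^sup>k\<close>, is then a section of \<open>F\<^sub>k(k) \<rightarrow> V\<^sub>k(k)\<close>, and it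
  is the shift of a section of \<open>F\<^sub>k \<rightarrow> V\<^sub>k\<close> because the shift is fully faithful. With these sections the
  hypothesis propagates to \<open>k - 1\<close>: \<open>F\<^sub>k\<close> retracts onto \<open>F\<^sub>k\<^sub>-\<^sub>1\<close>, hence so does \<open>V\<close>; and the composite
  \<open>V \<rightarrow> V(k) \<rightarrow> F\<^sub>k(k) \<rightarrow> V\<^sub>k(k) \<cong> V\<^sub>-\<^sub>k\<close> of \<open>e\<^sup>k\<close>, \<open>\<sigma>\<close>, the quotient arrow and the inverse isomorphism
  extends \<open>F\<^sub>-\<^sub>k \<rightarrow> V\<^sub>-\<^sub>k\<close> to \<open>V\<close>, which together with \<open>\<rho>\<close> yields a retraction of \<open>V\<close> onto \<open>F\<^sub>-\<^sub>k\<close>.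
\<close>

section \<open>Arrows in preadditive categories\<close>

text \<open>
  Hom-sets may overlap, so source and target are part of every statement about an arrow; bundling
  them with the two object conditions makes one premise per arrow enough in all the laws below.
\<close>

definition arr :: "('o, 'm) cat \<Rightarrow> 'o \<Rightarrow> 'o \<Rightarrow> 'm \<Rightarrow> bool" where
  "arr C X Y f \<longleftrightarrow> X \<in> Ob C \<and> Y \<in> Ob C \<and> f \<in> Hom C X Y"

context category
begin

lemma arr_id: "X \<in> Ob C \<Longrightarrow> arr C X X (Idn C X)"
  by (simp add: arr_def Idn_in_Hom)

lemma arr_comp: "\<lbrakk>arr C X Y f; arr C Y Z g\<rbrakk> \<Longrightarrow> arr C X Z (g \<cdot> f)"
  unfolding arr_def using Comp_in_Hom by blast

lemma comp_id: "arr C X Y f \<Longrightarrow> f \<cdot> Idn C X = f"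
  unfolding arr_def using Comp_Idn by blast

lemma id_comp: "arr C X Y f \<Longrightarrow> Idn C Y \<cdot> f = f"
  unfolding arr_def using Idn_Comp by blast

lemma assoc: "\<lbrakk>arr C W X f; arr C X Y g; arr C Y Z h\<rbrakk> \<Longrightarrow> (h \<cdot> g) \<cdot> f = h \<cdot> (g \<cdot> f)"
  unfolding arr_def using Comp_assoc by blast

end

lemma monic_cancel:
  "\<lbrakk>monic C X Y f; f \<cdot>\<^bsub>C\<^esub> u = f \<cdot>\<^bsub>C\<^esub> v; arr C Z X u; arr C Z X v\<rbrakk> \<Longrightarrow> u = v"
  by (auto simp: monic_def arr_def)

context preadditive_category
begin

lemma hom_comm_group: "arr C X Y f \<Longrightarrow> comm_group (hom_grp C X Y)"
  using comm_group_Hom by (simp add: arr_def)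

lemma arr_add: "\<lbrakk>arr C X Y f; arr C X Y g\<rbrakk> \<Longrightarrow> arr C X Y (Add C f g)"
proof -
  assume f: "arr C X Y f" and g: "arr C X Y g"
  interpret G: comm_group "hom_grp C X Y" by (rule hom_comm_group[OF f])
  show ?thesis using f g G.m_closed[of f g] by (simp add: arr_def hom_grp_def)
qed

lemma arr_zero: "\<lbrakk>X \<in> Ob C; Y \<in> Ob C\<rbrakk> \<Longrightarrow> arr C X Y (Zero C X Y)"
proof -
  assume X: "X \<in> Ob C" and Y: "Y \<in> Ob C"
  interpret G: comm_group "hom_grp C X Y" by (rule comm_group_Hom[OF X Y])
  show ?thesis using X Y G.one_closed by (simp add: arr_def hom_grp_def)
qed

lemma add_commute: "\<lbrakk>arr C X Y f; arr C X Y g\<rbrakk> \<Longrightarrow> Add C f g = Add C g f"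
proof -
  assume f: "arr C X Y f" and g: "arr C X Y g"
  interpret G: comm_group "hom_grp C X Y" by (rule hom_comm_group[OF f])
  show ?thesis using f g G.m_comm[of f g] by (simp add: arr_def hom_grp_def)
qed

lemma zero_add: "arr C X Y f \<Longrightarrow> Add C (Zero C X Y) f = f"
proof -
  assume f: "arr C X Y f"
  interpret G: comm_group "hom_grp C X Y" by (rule hom_comm_group[OF f])
  show ?thesis using f G.l_one[of f] by (simp add: arr_def hom_grp_def)
qed

lemma add_zero: "arr C X Y f \<Longrightarrow> Add C f (Zero C X Y) = f"
  by (metis zero_add add_commute arr_zero arr_def)

lemma add_cancel:
  "\<lbrakk>Add C f h = Add C g h; arr C X Y f; arr C X Y g; arr C X Y h\<rbrakk> \<Longrightarrow> f = g"
proof -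
  assume eq: "Add C f h = Add C g h" and f: "arr C X Y f" and g: "arr C X Y g" and h: "arr C X Y h"
  interpret G: comm_group "hom_grp C X Y" by (rule hom_comm_group[OF f])
  show ?thesis using eq f g h G.right_cancel[of h f g] by (simp add: arr_def hom_grp_def)
qed

lemma add_eq_self: "\<lbrakk>Add C f h = h; arr C X Y f; arr C X Y h\<rbrakk> \<Longrightarrow> f = Zero C X Y"
  by (metis add_cancel zero_add arr_zero arr_def)

lemma difference_exists:
  assumes f: "arr C X Y f" and g: "arr C X Y g"
  obtains h where "arr C X Y h" and "Add C h f = g"
proof -
  interpret G: comm_group "hom_grp C X Y" by (rule hom_comm_group[OF f])
  have c: "f \<in> carrier (hom_grp C X Y)" "g \<in> carrier (hom_grp C X Y)"
    using f g by (simp_all add: arr_def hom_grp_def)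
  let ?h = "g \<otimes>\<^bsub>hom_grp C X Y\<^esub> inv\<^bsub>hom_grp C X Y\<^esub> f"
  have "?h \<in> carrier (hom_grp C X Y)" "?h \<otimes>\<^bsub>hom_grp C X Y\<^esub> f = g"
    using c by (simp_all add: G.m_assoc)
  then show thesis using that[of ?h] f by (simp add: arr_def hom_grp_def)
qed

lemma comp_add:
  "\<lbrakk>arr C X Y f; arr C X Y g; arr C Y Z h\<rbrakk> \<Longrightarrow> h \<cdot> Add C f g = Add C (h \<cdot> f) (h \<cdot> g)"
  unfolding arr_def using Comp_Add by blast

lemma add_comp:
  "\<lbrakk>arr C X Y f; arr C Y Z g; arr C Y Z h\<rbrakk> \<Longrightarrow> Add C g h \<cdot> f = Add C (g \<cdot> f) (h \<cdot> f)"
  unfolding arr_def using Add_Comp by blast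

lemma comp_zero:
  assumes "arr C Y Z h" and "X \<in> Ob C"
  shows "h \<cdot> Zero C X Y = Zero C X Z"
proof -
  have z: "arr C X Y (Zero C X Y)" using assms arr_zero by (simp add: arr_def)
  have "Add C (h \<cdot> Zero C X Y) (h \<cdot> Zero C X Y) = h \<cdot> Zero C X Y"
    using comp_add[OF z z assms(1)] zero_add[OF z] by simp
  then show ?thesis using add_eq_self arr_comp[OF z assms(1)] by blast
qed

lemma zero_comp:
  assumes "arr C X Y f" and "Z \<in> Ob C"
  shows "Zero C Y Z \<cdot> f = Zero C X Z"
proof -
  have z: "arr C Y Z (Zero C Y Z)" using assms arr_zero by (simp add: arr_def)
  have "Add C (Zero C Y Z \<cdot> f) (Zero C Y Z \<cdot> f) = Zero C Y Z \<cdot> f"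
    using add_comp[OF assms(1) z z] zero_add[OF z] by simp
  then show ?thesis using add_eq_self arr_comp[OF assms(1) z] by blast
qed

lemma to_zero_object: "\<lbrakk>arr C X Z f; zero_object C Z\<rbrakk> \<Longrightarrow> f = Zero C X Z"
  by (metis (no_types, lifting) arr_def arr_zero zero_object_def)


section \<open>Direct sums as products\<close>

lemma arr_sum:
  assumes "X \<in> Ob C" "Y \<in> Ob C" "\<And>i. i \<in> I \<Longrightarrow> arr C X Y (f i)"
  shows "arr C X Y (finprod (hom_grp C X Y) f I)"
proof -
  interpret G: comm_group "hom_grp C X Y" by (rule comm_group_Hom[OF assms(1,2)])
  have "f \<in> I \<rightarrow> carrier (hom_grp C X Y)" using assms(3) by (simp add: arr_def hom_grp_def)
  then have "finprod (hom_grp C X Y) f I \<in> carrier (hom_grp C X Y)" by (rule G.finprod_closed)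
  then show ?thesis using assms(1,2) by (simp add: arr_def hom_grp_def)
qed

lemma sum_insert:
  assumes "X \<in> Ob C" "Y \<in> Ob C" "finite I" "i \<notin> I" "\<And>j. j \<in> insert i I \<Longrightarrow> arr C X Y (f j)"
  shows "finprod (hom_grp C X Y) f (insert i I) = Add C (f i) (finprod (hom_grp C X Y) f I)"
proof -
  interpret G: comm_group "hom_grp C X Y" by (rule comm_group_Hom[OF assms(1,2)])
  have "f \<in> I \<rightarrow> carrier (hom_grp C X Y)" "f i \<in> carrier (hom_grp C X Y)"
    using assms(5) by (simp_all add: arr_def hom_grp_def)
  then show ?thesis using G.finprod_insert[OF assms(3,4)] by (simp add: hom_grp_def)
qed

lemma sum_empty: "\<lbrakk>X \<in> Ob C; Y \<in> Ob C\<rbrakk> \<Longrightarrow> finprod (hom_grp C X Y) f {} = Zero C X Y"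
  using comm_monoid.finprod_empty[of "hom_grp C X Y" f] comm_group_Hom[of X Y]
  by (simp add: comm_group_def hom_grp_def)

lemma comp_sum:
  assumes "X \<in> Ob C" "arr C Y Z h" "finite I" "\<And>i. i \<in> I \<Longrightarrow> arr C X Y (f i)"
  shows "h \<cdot> finprod (hom_grp C X Y) f I = finprod (hom_grp C X Z) (\<lambda>i. h \<cdot> f i) I"
  using assms(3,4)
proof (induction I rule: finite_induct)
  case empty
  then show ?case using assms(1,2) by (simp add: arr_def sum_empty comp_zero[OF assms(2,1)])
next
  case (insert i I)
  have Y: "Y \<in> Ob C" and Z: "Z \<in> Ob C" using assms(2) by (simp_all add: arr_def)
  have a: "arr C X Y (finprod (hom_grp C X Y) f I)"
    using insert.prems by (intro arr_sum assms(1) Y) simp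
  have "h \<cdot> finprod (hom_grp C X Y) f (insert i I)
      = Add C (h \<cdot> f i) (h \<cdot> finprod (hom_grp C X Y) f I)"
    using sum_insert[OF assms(1) Y insert(1,2,4)] comp_add[OF insert(4) a assms(2)] by simp
  also have "\<dots> = finprod (hom_grp C X Z) (\<lambda>i. h \<cdot> f i) (insert i I)"
    using sum_insert[OF assms(1) Z insert(1,2), of "\<lambda>i. h \<cdot> f i"] insert.IH insert.prems
      arr_comp[OF insert.prems assms(2)] by simp
  finally show ?case .
qed

lemma sum_comp:
  assumes "Z \<in> Ob C" "arr C X Y h" "finite I" "\<And>i. i \<in> I \<Longrightarrow> arr C Y Z (f i)"
  shows "finprod (hom_grp C Y Z) f I \<cdot> h = finprod (hom_grp C X Z) (\<lambda>i. f i \<cdot> h) I"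
  using assms(3,4)
proof (induction I rule: finite_induct)
  case empty
  then show ?case using assms(1,2) by (simp add: arr_def sum_empty zero_comp[OF assms(2,1)])
next
  case (insert i I)
  have X: "X \<in> Ob C" and Y: "Y \<in> Ob C" using assms(2) by (simp_all add: arr_def)
  have a: "arr C Y Z (finprod (hom_grp C Y Z) f I)"
    using insert.prems by (intro arr_sum assms(1) Y) simp
  have "finprod (hom_grp C Y Z) f (insert i I) \<cdot> h
      = Add C (f i \<cdot> h) (finprod (hom_grp C Y Z) f I \<cdot> h)"
    using sum_insert[OF Y assms(1) insert(1,2,4)] add_comp[OF assms(2) insert(4) a] by simp
  also have "\<dots> = finprod (hom_grp C X Z) (\<lambda>i. f i \<cdot> h) (insert i I)"
    using sum_insert[OF X assms(1) insert(1,2), of "\<lambda>i. f i \<cdot> h"] insert.IH insert.prems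
      arr_comp[OF assms(2) insert.prems] by simp
  finally show ?case .
qed

lemma sum_cong:
  assumes "X \<in> Ob C" "Y \<in> Ob C" "\<And>i. i \<in> I \<Longrightarrow> f i = g i" "\<And>i. i \<in> I \<Longrightarrow> arr C X Y (g i)"
  shows "finprod (hom_grp C X Y) f I = finprod (hom_grp C X Y) g I"
proof -
  interpret G: comm_group "hom_grp C X Y" by (rule comm_group_Hom[OF assms(1,2)])
  show ?thesis using assms(3,4) by (intro G.finprod_cong') (auto simp: arr_def hom_grp_def)
qed

lemma sum_delta:
  assumes "X \<in> Ob C" "Y \<in> Ob C" "finite I" "j \<in> I" "\<And>i. i \<in> I \<Longrightarrow> arr C X Y (f i)"
  shows "finprod (hom_grp C X Y) (\<lambda>i. if j = i then f i else Zero C X Y) I = f j"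
proof -
  interpret G: comm_group "hom_grp C X Y" by (rule comm_group_Hom[OF assms(1,2)])
  have "f \<in> I \<rightarrow> carrier (hom_grp C X Y)" using assms(5) by (simp add: arr_def hom_grp_def)
  moreover have one: "\<one>\<^bsub>hom_grp C X Y\<^esub> = Zero C X Y" by (simp add: hom_grp_def)
  ultimately show ?thesis using G.finprod_singleton[OF assms(4,3), of f, unfolded one] by simp
qed

lemma direct_sum_arr:
  assumes "direct_sum C I X W \<iota> \<pi>" "i \<in> I"
  shows "arr C (X i) W (\<iota> i)" "arr C W (X i) (\<pi> i)"
  using assms by (simp_all add: direct_sum_def arr_def)

text \<open>
  As the \<open>\<iota> i \<cdot> \<pi> i\<close> add up to the identity, an arrow into a direct sum is recovered from its
  components.
\<close>

lemma direct_sum_ext: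
  assumes ds: "direct_sum C I X W \<iota> \<pi>" and u: "arr C Z W u" and v: "arr C Z W v"
    and eq: "\<And>i. i \<in> I \<Longrightarrow> \<pi> i \<cdot> u = \<pi> i \<cdot> v"
  shows "u = v"
proof -
  have fin: "finite I" and W: "W \<in> Ob C" and Z: "Z \<in> Ob C"
    and id: "finprod (hom_grp C W W) (\<lambda>i. \<iota> i \<cdot> \<pi> i) I = Idn C W"
    using ds u by (simp_all add: direct_sum_def arr_def)
  note a = direct_sum_arr[OF ds]
  have expand: "w = finprod (hom_grp C Z W) (\<lambda>i. \<iota> i \<cdot> (\<pi> i \<cdot> w)) I" if w: "arr C Z W w" for w
  proof -
    have "w = finprod (hom_grp C W W) (\<lambda>i. \<iota> i \<cdot> \<pi> i) I \<cdot> w" using id id_comp[OF w] by simp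
    also have "\<dots> = finprod (hom_grp C Z W) (\<lambda>i. (\<iota> i \<cdot> \<pi> i) \<cdot> w) I"
      by (rule sum_comp[OF W w fin]) (rule arr_comp[OF a(2,1)])
    also have "\<dots> = finprod (hom_grp C Z W) (\<lambda>i. \<iota> i \<cdot> (\<pi> i \<cdot> w)) I"
      by (rule sum_cong[OF Z W]) (use assoc[OF w a(2,1)] arr_comp[OF arr_comp[OF w a(2)] a(1)] in auto)
    finally show ?thesis .
  qed
  have "u = finprod (hom_grp C Z W) (\<lambda>i. \<iota> i \<cdot> (\<pi> i \<cdot> u)) I" by (rule expand[OF u])
  also have "\<dots> = finprod (hom_grp C Z W) (\<lambda>i. \<iota> i \<cdot> (\<pi> i \<cdot> v)) I"
    by (rule sum_cong[OF Z W]) (use eq arr_comp[OF arr_comp[OF v a(2)] a(1)] in auto)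
  also have "\<dots> = v" by (rule expand[OF v, symmetric])
  finally show ?thesis .
qed

text \<open>
  The component at \<open>j\<close> of the sum of all \<open>\<iota> i \<cdot> g i\<close> is \<open>g j\<close> by orthogonality. Together with
  the previous lemma this is the universal property of a product.
\<close>

lemma direct_sum_tuple:
  assumes ds: "direct_sum C I X W \<iota> \<pi>" and Z: "Z \<in> Ob C" and g: "\<And>i. i \<in> I \<Longrightarrow> arr C Z (X i) (g i)"
  obtains u where "arr C Z W u" and "\<And>i. i \<in> I \<Longrightarrow> \<pi> i \<cdot> u = g i"
proof -
  have fin: "finite I" and W: "W \<in> Ob C" and X: "\<And>i. i \<in> I \<Longrightarrow> X i \<in> Ob C"
    and orth: "\<And>i j. \<lbrakk>i \<in> I; j \<in> I\<rbrakk>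
      \<Longrightarrow> \<pi> j \<cdot> \<iota> i = (if i = j then Idn C (X i) else Zero C (X i) (X j))"
    using ds by (simp_all add: direct_sum_def)
  note a = direct_sum_arr[OF ds]
  note ag = arr_comp[OF g a(1)]
  define u where "u = finprod (hom_grp C Z W) (\<lambda>i. \<iota> i \<cdot> g i) I"
  have u: "arr C Z W u" unfolding u_def by (rule arr_sum[OF Z W]) (rule ag)
  moreover have "\<pi> j \<cdot> u = g j" if j: "j \<in> I" for j
  proof -
    have "\<pi> j \<cdot> u = finprod (hom_grp C Z (X j)) (\<lambda>i. \<pi> j \<cdot> (\<iota> i \<cdot> g i)) I"
      unfolding u_def by (rule comp_sum[OF Z a(2)[OF j] fin]) (rule ag)
    also have "\<dots> = finprod (hom_grp C Z (X j)) (\<lambda>i. if j = i then g j else Zero C Z (X j)) I"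
    proof (rule sum_cong[OF Z X[OF j]])
      fix i assume i: "i \<in> I"
      have "\<pi> j \<cdot> (\<iota> i \<cdot> g i) = (\<pi> j \<cdot> \<iota> i) \<cdot> g i"
        by (rule assoc[OF g[OF i] a(1)[OF i] a(2)[OF j], symmetric])
      then show "\<pi> j \<cdot> (\<iota> i \<cdot> g i) = (if j = i then g j else Zero C Z (X j))"
        using orth[OF i j] id_comp[OF g[OF i]] zero_comp[OF g[OF i] X[OF j]] by auto
      show "arr C Z (X j) (if j = i then g j else Zero C Z (X j))"
        using g[OF j] arr_zero[OF Z X[OF j]] by (cases "j = i") simp_all
    qed
    also have "\<dots> = g j" using sum_delta[OF Z X[OF j] fin j, of "\<lambda>_. g j"] g[OF j] by simp
    finally show ?thesis .
  qed
  ultimately show thesis by (rule that)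
qed

text \<open>
  Both \<open>W\<close> and \<open>V\<close> are products of the same family, and the isomorphism between two products is
  determined by its compatibility with the projections.
\<close>

lemma direct_sum_unique:
  assumes ds: "direct_sum C I X W \<iota> \<pi>" and ds': "direct_sum C I X V \<iota>' \<pi>'"
  obtains \<phi> where "iso_arrow C W V \<phi>" and "\<And>i. i \<in> I \<Longrightarrow> \<pi>' i \<cdot> \<phi> = \<pi> i"
proof -
  have W: "W \<in> Ob C" and V: "V \<in> Ob C" using ds ds' by (simp_all add: direct_sum_def)
  note a = direct_sum_arr[OF ds] and a' = direct_sum_arr[OF ds']
  obtain \<phi> where \<phi>: "arr C W V \<phi>" and \<phi>c: "\<And>i. i \<in> I \<Longrightarrow> \<pi>' i \<cdot> \<phi> = \<pi> i"
    using direct_sum_tuple[OF ds' W, of \<pi>] a(2) by blast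
  obtain \<psi> where \<psi>: "arr C V W \<psi>" and \<psi>c: "\<And>i. i \<in> I \<Longrightarrow> \<pi> i \<cdot> \<psi> = \<pi>' i"
    using direct_sum_tuple[OF ds V, of \<pi>'] a'(2) by blast
  have "\<psi> \<cdot> \<phi> = Idn C W"
    by (rule direct_sum_ext[OF ds arr_comp[OF \<phi> \<psi>] arr_id[OF W]])
      (simp add: assoc[OF \<phi> \<psi> a(2), symmetric] \<phi>c \<psi>c comp_id[OF a(2)])
  moreover have "\<phi> \<cdot> \<psi> = Idn C V"
    by (rule direct_sum_ext[OF ds' arr_comp[OF \<psi> \<phi>] arr_id[OF V]])
      (simp add: assoc[OF \<psi> \<phi> a'(2), symmetric] \<phi>c \<psi>c comp_id[OF a'(2)])
  ultimately have "iso_arrow C W V \<phi>" using \<phi> \<psi> by (auto simp: iso_arrow_def arr_def)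
  then show thesis using \<phi>c by (rule that)
qed

end


section \<open>Filtered objects\<close>

lemma AF_simps [simp]:
  "V \<in> Ob (AF A) \<longleftrightarrow> filtered_object A V"
  "Idn (AF A) V = Idn A (Tot V)"
  "Comp (AF A) = Comp A"
  "Add (AF A) = Add A"
  "Zero (AF A) V W = Zero A (Tot V) (Tot W)"
  by (simp_all add: AF_def)

locale filtered_obj = abelian_category +
  fixes V
  assumes filtered: "filtered_object C V"
begin

lemma Tot_ob: "Tot V \<in> Ob C"
  using filtered by (simp add: filtered_object_def)

lemma Fil_ob: "Fil V p \<in> Ob C"
  using filtered by (simp add: filtered_object_def)

lemma Inc_monic: "monic C (Fil V p) (Tot V) (Inc V p)"
  using filtered by (simp add: filtered_object_def)

lemma Inc_arr: "arr C (Fil V p) (Tot V) (Inc V p)"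
  using Inc_monic Tot_ob Fil_ob by (simp add: monic_def arr_def)

lemmas Inc_cancel = monic_cancel[OF Inc_monic]

lemma step_props: "step C V p \<in> Hom C (Fil V (p - 1)) (Fil V p) \<and> Inc V p \<cdot> step C V p = Inc V (p - 1)"
proof -
  obtain j where j: "j \<in> Hom C (Fil V (p - 1)) (Fil V p)" "Inc V p \<cdot> j = Inc V (p - 1)"
    using filtered unfolding filtered_object_def by blast
  \<comment> \<open>the inclusion is unique since \<open>Inc V p\<close> is monic\<close>
  show ?thesis unfolding step_def
  proof (rule theI)
    fix j' assume "j' \<in> Hom C (Fil V (p - 1)) (Fil V p) \<and> Inc V p \<cdot> j' = Inc V (p - 1)"
    then show "j' = j" using j Fil_ob by (intro Inc_cancel[of p j' j]) (auto simp: arr_def)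
  qed (use j in simp)
qed

lemma step_arr: "arr C (Fil V (p - 1)) (Fil V p) (step C V p)"
  using step_props Fil_ob by (simp add: arr_def)

lemma Inc_step: "Inc V p \<cdot> step C V p = Inc V (p - 1)"
  using step_props by simp

lemma step_monic: "monic C (Fil V (p - 1)) (Fil V p) (step C V p)"
  unfolding monic_def
proof (intro conjI ballI impI)
  show "step C V p \<in> Hom C (Fil V (p - 1)) (Fil V p)" using step_props by simp
  fix Z u v assume "Z \<in> Ob C" "u \<in> Hom C Z (Fil V (p - 1))" "v \<in> Hom C Z (Fil V (p - 1))"
    and eq: "step C V p \<cdot> u = step C V p \<cdot> v"
  then have u: "arr C Z (Fil V (p - 1)) u" and v: "arr C Z (Fil V (p - 1)) v"
    using Fil_ob by (auto simp: arr_def)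
  have "Inc V (p - 1) \<cdot> u = Inc V (p - 1) \<cdot> v"
    using assoc[OF u step_arr Inc_arr] assoc[OF v step_arr Inc_arr] eq Inc_step by simp
  then show "u = v" by (rule Inc_cancel[OF _ u v])
qed

lemma Fil_mono:
  assumes "p \<le> i"
  obtains j where "arr C (Fil V p) (Fil V i) j" and "Inc V i \<cdot> j = Inc V p"
proof -
  have "\<exists>j. arr C (Fil V p) (Fil V i) j \<and> Inc V i \<cdot> j = Inc V p"
    using assms
  proof (induction i rule: int_ge_induct)
    case base
    then show ?case using arr_id[OF Fil_ob] comp_id[OF Inc_arr] by blast
  next
    case (step i)
    then obtain j where j: "arr C (Fil V p) (Fil V i) j" "Inc V i \<cdot> j = Inc V p" by blast
    have s: "arr C (Fil V i) (Fil V (i + 1)) (step C V (i + 1))"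
      and I: "Inc V (i + 1) \<cdot> step C V (i + 1) = Inc V i"
      using step_arr[of "i + 1"] Inc_step[of "i + 1"] by simp_all
    show ?case using arr_comp[OF j(1) s] assoc[OF j(1) s Inc_arr] I j(2) by metis
  qed
  then show thesis using that by blast
qed

lemma gr_cokernel:
  "is_cokernel C (Fil V (p - 1)) (Fil V p) (step C V p) (gr C V p) (gr_proj C V p)"
proof -
  have "\<exists>x. case x of (Q, q) \<Rightarrow> is_cokernel C (Fil V (p - 1)) (Fil V p) (step C V p) Q q"
    using cokernel_exists[OF Fil_ob Fil_ob, of "step C V p" "p - 1" p] step_props by auto
  from someI_ex[OF this] show ?thesis
    by (simp add: gr_def gr_proj_def gr_quot_def case_prod_unfold)
qed

lemma gr_ob: "gr C V p \<in> Ob C"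
  using gr_cokernel by (simp add: is_cokernel_def)

lemma proj_arr: "arr C (Fil V p) (gr C V p) (gr_proj C V p)"
  using gr_cokernel[of p] Fil_ob by (simp add: is_cokernel_def arr_def)

lemma proj_step: "gr_proj C V p \<cdot> step C V p = Zero C (Fil V (p - 1)) (gr C V p)"
  using gr_cokernel[of p] by (simp add: is_cokernel_def)

lemma proj_factor:
  assumes "arr C (Fil V p) Z u" "u \<cdot> step C V p = Zero C (Fil V (p - 1)) Z"
  obtains v where "arr C (gr C V p) Z v" and "v \<cdot> gr_proj C V p = u"
  using gr_cokernel[of p] assms unfolding is_cokernel_def arr_def by blast

lemma proj_cancel:
  assumes "u \<cdot> gr_proj C V p = v \<cdot> gr_proj C V p" "arr C (gr C V p) Z u" "arr C (gr C V p) Z v"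
  shows "u = v"
proof -
  let ?w = "u \<cdot> gr_proj C V p"
  have w: "arr C (Fil V p) Z ?w" by (rule arr_comp[OF proj_arr assms(2)])
  have Z: "Z \<in> Ob C" using assms(2) by (simp add: arr_def)
  have "?w \<cdot> step C V p = Zero C (Fil V (p - 1)) Z"
    using assoc[OF step_arr proj_arr assms(2)] comp_zero[OF assms(2) Fil_ob] proj_step by simp
  then have "\<exists>!x. x \<in> Hom C (gr C V p) Z \<and> x \<cdot> gr_proj C V p = ?w"
    using gr_cokernel[of p] w Z unfolding is_cokernel_def arr_def by blast
  then show ?thesis using assms by (metis arr_def)
qed

text \<open>
  Exactness at \<open>Fil V p\<close>: a monomorphism is a kernel of some arrow, and that arrow factors through
  every cokernel of the monomorphism, so \<open>step C V p\<close> is also a kernel of its cokernel.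
\<close>

lemma step_factor:
  assumes u: "arr C Z (Fil V p) u" and q: "gr_proj C V p \<cdot> u = Zero C Z (gr C V p)"
  obtains v where "arr C Z (Fil V (p - 1)) v" and "step C V p \<cdot> v = u"
proof -
  have Z: "Z \<in> Ob C" using u by (simp add: arr_def)
  obtain Y g where Y: "Y \<in> Ob C" "g \<in> Hom C (Fil V p) Y"
    and ker: "is_kernel C (Fil V p) Y g (Fil V (p - 1)) (step C V p)"
    using monic_is_kernel[OF Fil_ob Fil_ob step_monic] by blast
  then have g: "arr C (Fil V p) Y g" using Fil_ob by (simp add: arr_def)
  have "g \<cdot> step C V p = Zero C (Fil V (p - 1)) Y" using ker by (simp add: is_kernel_def)
  from proj_factor[OF g this] obtain h where h: "arr C (gr C V p) Y h" "h \<cdot> gr_proj C V p = g" .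
  have "g \<cdot> u = Zero C Z Y"
    using assoc[OF u proj_arr h(1)] h(2) q comp_zero[OF h(1) Z] by simp
  then show thesis using ker u Z Fil_ob that unfolding is_kernel_def arr_def by blast
qed

text \<open>
  Splitting the short exact sequence \<open>Fil V (p - 1) \<rightarrow> Fil V p \<rightarrow> gr C V p\<close> on either side splits it
  on the other. If \<open>t\<close> is a retraction, the identity minus \<open>step \<cdot> t\<close> kills \<open>step\<close> and hence
  factors through the quotient; the second factor is a section.
\<close>

lemma section_of_retraction:
  assumes t: "arr C (Fil V p) (Fil V (p - 1)) t" and ts: "t \<cdot> step C V p = Idn C (Fil V (p - 1))"
  obtains s where "arr C (gr C V p) (Fil V p) s" "gr_proj C V p \<cdot> s = Idn C (gr C V p)"
    "Add C (s \<cdot> gr_proj C V p) (step C V p \<cdot> t) = Idn C (Fil V p)"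
proof -
  let ?j = "step C V p" and ?q = "gr_proj C V p" and ?F = "Fil V p" and ?F' = "Fil V (p - 1)"
  have jt: "arr C ?F ?F (?j \<cdot> t)" by (rule arr_comp[OF t step_arr])
  obtain h where h: "arr C ?F ?F h" "Add C h (?j \<cdot> t) = Idn C ?F"
    using difference_exists[OF jt arr_id[OF Fil_ob]] by blast
  have hj: "arr C ?F' ?F (h \<cdot> ?j)" by (rule arr_comp[OF step_arr h(1)])
  have "Add C (h \<cdot> ?j) ?j = Add C h (?j \<cdot> t) \<cdot> ?j"
    using add_comp[OF step_arr h(1) jt] assoc[OF step_arr t step_arr] ts comp_id[OF step_arr] by simp
  also have "\<dots> = ?j" using h(2) id_comp[OF step_arr] by simp
  finally have "h \<cdot> ?j = Zero C ?F' ?F" using add_eq_self hj step_arr by blast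
  from proj_factor[OF h(1) this] obtain s where s: "arr C (gr C V p) ?F s" "s \<cdot> ?q = h" .
  have "?q \<cdot> (?j \<cdot> t) = Zero C ?F (gr C V p)"
    using assoc[OF t step_arr proj_arr] proj_step zero_comp[OF t gr_ob] by simp
  then have "?q \<cdot> h = ?q \<cdot> Add C h (?j \<cdot> t)"
    using comp_add[OF h(1) jt proj_arr] add_zero[OF arr_comp[OF h(1) proj_arr]] by simp
  also have "\<dots> = Idn C (gr C V p) \<cdot> ?q" using h(2) comp_id[OF proj_arr] id_comp[OF proj_arr] by simp
  finally have "(?q \<cdot> s) \<cdot> ?q = Idn C (gr C V p) \<cdot> ?q" using assoc[OF proj_arr s(1) proj_arr] s(2) by simp
  then have "?q \<cdot> s = Idn C (gr C V p)"
    by (rule proj_cancel[OF _ arr_comp[OF s(1) proj_arr] arr_id[OF gr_ob]])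
  then show thesis using that s h(2) by blast
qed

text \<open>
  Dually, the identity minus \<open>s \<cdot> gr_proj\<close> is killed by \<open>gr_proj\<close> and hence factors through
  \<open>step\<close>. The relation \<open>t \<cdot> s = 0\<close> is what later makes the summands orthogonal.
\<close>

lemma retraction_of_section:
  assumes s: "arr C (gr C V p) (Fil V p) s" and qs: "gr_proj C V p \<cdot> s = Idn C (gr C V p)"
  obtains t where "arr C (Fil V p) (Fil V (p - 1)) t" "t \<cdot> step C V p = Idn C (Fil V (p - 1))"
    "Add C (step C V p \<cdot> t) (s \<cdot> gr_proj C V p) = Idn C (Fil V p)"
    "t \<cdot> s = Zero C (gr C V p) (Fil V (p - 1))"
proof -
  let ?j = "step C V p" and ?q = "gr_proj C V p" and ?F = "Fil V p" and ?F' = "Fil V (p - 1)"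
  have sq: "arr C ?F ?F (s \<cdot> ?q)" by (rule arr_comp[OF proj_arr s])
  obtain h where h: "arr C ?F ?F h" "Add C h (s \<cdot> ?q) = Idn C ?F"
    using difference_exists[OF sq arr_id[OF Fil_ob]] by blast
  have "Add C (?q \<cdot> h) ?q = ?q \<cdot> Add C h (s \<cdot> ?q)"
    using comp_add[OF h(1) sq proj_arr] assoc[OF proj_arr s proj_arr] qs id_comp[OF proj_arr] by simp
  also have "\<dots> = ?q" using h(2) comp_id[OF proj_arr] by simp
  finally have "?q \<cdot> h = Zero C ?F (gr C V p)"
    using add_eq_self arr_comp[OF h(1) proj_arr] proj_arr by blast
  from step_factor[OF h(1) this] obtain t where t: "arr C ?F ?F' t" "?j \<cdot> t = h" .
  have "(s \<cdot> ?q) \<cdot> ?j = Zero C ?F' ?F"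
    using assoc[OF step_arr proj_arr s] proj_step comp_zero[OF s Fil_ob] by simp
  then have "h \<cdot> ?j = Add C h (s \<cdot> ?q) \<cdot> ?j"
    using add_comp[OF step_arr h(1) sq] add_zero[OF arr_comp[OF step_arr h(1)]] by simp
  also have "\<dots> = ?j" using h(2) id_comp[OF step_arr] by simp
  finally have "?j \<cdot> (t \<cdot> ?j) = ?j \<cdot> Idn C ?F'"
    using assoc[OF step_arr t(1) step_arr] t(2) comp_id[OF step_arr] by simp
  then have tj: "t \<cdot> ?j = Idn C ?F'"
    by (rule monic_cancel[OF step_monic _ arr_comp[OF step_arr t(1)] arr_id[OF Fil_ob]])
  have hs: "arr C (gr C V p) ?F (h \<cdot> s)" by (rule arr_comp[OF s h(1)])
  have "Add C (h \<cdot> s) s = Add C h (s \<cdot> ?q) \<cdot> s"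
    using add_comp[OF s h(1) sq] assoc[OF s proj_arr s] qs comp_id[OF s] by simp
  also have "\<dots> = s" using h(2) id_comp[OF s] by simp
  finally have "h \<cdot> s = Zero C (gr C V p) ?F" using add_eq_self hs s by blast
  then have "?j \<cdot> (t \<cdot> s) = ?j \<cdot> Zero C (gr C V p) ?F'"
    using assoc[OF s t(1) step_arr] t(2) comp_zero[OF step_arr gr_ob] by simp
  then have ts: "t \<cdot> s = Zero C (gr C V p) ?F'"
    by (rule monic_cancel[OF step_monic _ arr_comp[OF s t(1)] arr_zero[OF gr_ob Fil_ob]])
  show thesis using that[OF t(1) tj _ ts] t(2) h(2) by simp
qed

text \<open>
  One symmetric bound for both ends of the filtration, which can be taken as large as desired: the
  inductions below run over symmetric intervals.
\<close>

lemma filtration_bound: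
  obtains N :: nat where "\<And>p. int N \<le> p \<Longrightarrow> iso_arrow C (Fil V p) (Tot V) (Inc V p)"
    and "\<And>p. p \<le> - int N \<Longrightarrow> zero_object C (Fil V p)" and "M \<le> N"
proof -
  obtain a b where "\<And>p. p \<le> a \<Longrightarrow> zero_object C (Fil V p)"
    "\<And>p. b \<le> p \<Longrightarrow> iso_arrow C (Fil V p) (Tot V) (Inc V p)"
    using filtered by (auto simp: filtered_object_def)
  then show thesis using that[of "M + nat \<bar>a\<bar> + nat \<bar>b\<bar>"] by auto
qed

end


section \<open>Filtered arrows form a preadditive category\<close>

lemma AF_HomI:
  assumes "arr A (Tot V) (Tot W) f"
    and "\<And>p. \<exists>g. arr A (Fil V p) (Fil W p) g \<and> Inc W p \<cdot>\<^bsub>A\<^esub> g = f \<cdot>\<^bsub>A\<^esub> Inc V p"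
  shows "f \<in> Hom (AF A) V W"
  using assms by (fastforce simp: AF_def arr_def)

lemma AF_HomD:
  assumes "f \<in> Hom (AF A) V W" "filtered_object A V" "filtered_object A W"
  shows "arr A (Tot V) (Tot W) f"
    and "\<exists>g. arr A (Fil V p) (Fil W p) g \<and> Inc W p \<cdot>\<^bsub>A\<^esub> g = f \<cdot>\<^bsub>A\<^esub> Inc V p"
  using assms by (auto simp: AF_def arr_def filtered_object_def)

lemma (in abelian_category) filtered_objI: "filtered_object C V \<Longrightarrow> filtered_obj C V"
  by (simp add: filtered_obj_def filtered_obj_axioms_def abelian_category_axioms)

lemma (in abelian_category) AF_Comp_in_Hom:
  assumes U: "filtered_object C U" and V: "filtered_object C V" and W: "filtered_object C W"
    and f: "f \<in> Hom (AF C) U V" and g: "g \<in> Hom (AF C) V W"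
  shows "g \<cdot> f \<in> Hom (AF C) U W"
proof (rule AF_HomI)
  interpret U: filtered_obj C U by (rule filtered_objI[OF U])
  interpret V: filtered_obj C V by (rule filtered_objI[OF V])
  interpret W: filtered_obj C W by (rule filtered_objI[OF W])
  note f' = AF_HomD[OF f U V] and g' = AF_HomD[OF g V W]
  show "arr C (Tot U) (Tot W) (g \<cdot> f)" by (rule arr_comp[OF f'(1) g'(1)])
  fix p
  obtain a where a: "arr C (Fil U p) (Fil V p) a" "Inc V p \<cdot> a = f \<cdot> Inc U p" using f'(2) by blast
  obtain b where b: "arr C (Fil V p) (Fil W p) b" "Inc W p \<cdot> b = g \<cdot> Inc V p" using g'(2) by blast
  have "Inc W p \<cdot> (b \<cdot> a) = (g \<cdot> Inc V p) \<cdot> a" using assoc[OF a(1) b(1) W.Inc_arr] b(2) by simp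
  also have "\<dots> = g \<cdot> (f \<cdot> Inc U p)" using assoc[OF a(1) V.Inc_arr g'(1)] a(2) by simp
  also have "\<dots> = (g \<cdot> f) \<cdot> Inc U p" by (rule assoc[OF U.Inc_arr f'(1) g'(1), symmetric])
  finally show "\<exists>c. arr C (Fil U p) (Fil W p) c \<and> Inc W p \<cdot> c = (g \<cdot> f) \<cdot> Inc U p"
    using arr_comp[OF a(1) b(1)] by blast
qed

text \<open>
  The restrictions of \<open>f\<close> to the steps of the filtrations can be added and negated along with \<open>f\<close>.
\<close>

lemma (in abelian_category) AF_hom_subgroup:
  assumes V: "filtered_object C V" and W: "filtered_object C W"
  shows "subgroup (Hom (AF C) V W) (hom_grp C (Tot V) (Tot W))"
proof -
  interpret V: filtered_obj C V by (rule filtered_objI[OF V])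
  interpret W: filtered_obj C W by (rule filtered_objI[OF W])
  let ?G = "hom_grp C (Tot V) (Tot W)"
  interpret G: comm_group ?G by (rule comm_group_Hom[OF V.Tot_ob W.Tot_ob])
  note D = AF_HomD[OF _ V W]
  have zero: "Zero C (Tot V) (Tot W) \<in> Hom (AF C) V W"
  proof (rule AF_HomI)
    fix p
    show "\<exists>g. arr C (Fil V p) (Fil W p) g \<and> Inc W p \<cdot> g = Zero C (Tot V) (Tot W) \<cdot> Inc V p"
      using arr_zero[OF V.Fil_ob W.Fil_ob] comp_zero[OF W.Inc_arr V.Fil_ob]
        zero_comp[OF V.Inc_arr W.Tot_ob] by metis
  qed (rule arr_zero[OF V.Tot_ob W.Tot_ob])
  show ?thesis
  proof (rule G.subgroupI)
    show "Hom (AF C) V W \<subseteq> carrier ?G" by (auto simp: AF_def hom_grp_def)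
    show "Hom (AF C) V W \<noteq> {}" using zero by blast
  next
    fix f assume fH: "f \<in> Hom (AF C) V W"
    then have f: "arr C (Tot V) (Tot W) f" by (rule D)
    then have fc: "f \<in> carrier ?G" by (simp add: hom_grp_def arr_def)
    let ?n = "inv\<^bsub>?G\<^esub> f"
    have n: "arr C (Tot V) (Tot W) ?n" and nf: "Add C ?n f = Zero C (Tot V) (Tot W)"
      using G.inv_closed[OF fc] G.l_inv[OF fc] V.Tot_ob W.Tot_ob by (simp_all add: hom_grp_def arr_def)
    show "?n \<in> Hom (AF C) V W"
    proof (rule AF_HomI[OF n])
      fix p
      obtain g where g: "arr C (Fil V p) (Fil W p) g" "Inc W p \<cdot> g = f \<cdot> Inc V p"
        using D(2)[OF fH] by blast
      obtain g' where g': "arr C (Fil V p) (Fil W p) g'" "Add C g' g = Zero C (Fil V p) (Fil W p)"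
        using difference_exists[OF g(1) arr_zero[OF V.Fil_ob W.Fil_ob]] by blast
      have "Add C (Inc W p \<cdot> g') (Inc W p \<cdot> g) = Zero C (Fil V p) (Tot W)"
        using comp_add[OF g'(1) g(1) W.Inc_arr] g'(2) comp_zero[OF W.Inc_arr V.Fil_ob] by simp
      also have "\<dots> = Add C (?n \<cdot> Inc V p) (Inc W p \<cdot> g)"
        using add_comp[OF V.Inc_arr n f] nf g(2) zero_comp[OF V.Inc_arr W.Tot_ob] by simp
      finally have "Inc W p \<cdot> g' = ?n \<cdot> Inc V p"
        by (rule add_cancel[OF _ arr_comp[OF g'(1) W.Inc_arr] arr_comp[OF V.Inc_arr n]
              arr_comp[OF g(1) W.Inc_arr]])
      then show "\<exists>g. arr C (Fil V p) (Fil W p) g \<and> Inc W p \<cdot> g = ?n \<cdot> Inc V p"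
        using g'(1) by blast
    qed
  next
    fix f f' assume fH: "f \<in> Hom (AF C) V W" "f' \<in> Hom (AF C) V W"
    note f = D(1)[OF fH(1)] and f' = D(1)[OF fH(2)]
    have "Add C f f' \<in> Hom (AF C) V W"
    proof (rule AF_HomI[OF arr_add[OF f f']])
      fix p
      obtain g where g: "arr C (Fil V p) (Fil W p) g" "Inc W p \<cdot> g = f \<cdot> Inc V p"
        using D(2)[OF fH(1)] by blast
      obtain g' where g': "arr C (Fil V p) (Fil W p) g'" "Inc W p \<cdot> g' = f' \<cdot> Inc V p"
        using D(2)[OF fH(2)] by blast
      have "Inc W p \<cdot> Add C g g' = Add C f f' \<cdot> Inc V p"
        using comp_add[OF g(1) g'(1) W.Inc_arr] add_comp[OF V.Inc_arr f f'] g(2) g'(2) by simp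
      then show "\<exists>h. arr C (Fil V p) (Fil W p) h \<and> Inc W p \<cdot> h = Add C f f' \<cdot> Inc V p"
        using arr_add[OF g(1) g'(1)] by blast
    qed
    then show "f \<otimes>\<^bsub>?G\<^esub> f' \<in> Hom (AF C) V W" by (simp add: hom_grp_def)
  qed
qed

text \<open>
  Direct sums of filtered objects are sums in this category, so the uniqueness of direct sums has to
  be available for it and not only for the underlying category.
\<close>

lemma (in abelian_category) preadditive_AF: "preadditive_category (AF C)"
proof (intro preadditive_category.intro category.intro preadditive_category_axioms.intro)
  fix V assume V: "V \<in> Ob (AF C)"
  then have V: "filtered_object C V" by simp
  interpret V: filtered_obj C V by (rule filtered_objI[OF V])
  show "Idn (AF C) V \<in> Hom (AF C) V V"
  proof (rule AF_HomI)
    fix p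
    show "\<exists>g. arr C (Fil V p) (Fil V p) g \<and> Inc V p \<cdot> g = Idn (AF C) V \<cdot> Inc V p"
      using arr_id[OF V.Fil_ob] comp_id[OF V.Inc_arr] id_comp[OF V.Inc_arr] by auto
  qed (simp add: arr_id[OF V.Tot_ob])
next
  fix V W assume "V \<in> Ob (AF C)" "W \<in> Ob (AF C)"
  then have V: "filtered_object C V" and W: "filtered_object C W" by simp_all
  have ob: "Tot V \<in> Ob C" "Tot W \<in> Ob C" using V W by (simp_all add: filtered_object_def)
  have eq: "hom_grp (AF C) V W = (hom_grp C (Tot V) (Tot W))\<lparr>carrier := Hom (AF C) V W\<rparr>"
    by (simp add: hom_grp_def)
  interpret G: comm_group "hom_grp C (Tot V) (Tot W)" by (rule comm_group_Hom[OF ob])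
  have sub: "subgroup (Hom (AF C) V W) (hom_grp C (Tot V) (Tot W))" by (rule AF_hom_subgroup[OF V W])
  have grp: "group (hom_grp (AF C) V W)"
    unfolding eq by (rule G.subgroup_imp_group[OF sub])
  show "comm_group (hom_grp (AF C) V W)"
  proof (rule group.group_comm_groupI[OF grp])
    fix f g assume "f \<in> carrier (hom_grp (AF C) V W)" "g \<in> carrier (hom_grp (AF C) V W)"
    then show "f \<otimes>\<^bsub>hom_grp (AF C) V W\<^esub> g = g \<otimes>\<^bsub>hom_grp (AF C) V W\<^esub> f"
      using G.m_comm[of f g] subgroup.subset[OF sub] by (auto simp: hom_grp_def)
  qed
next
  fix U V W f g
  assume "U \<in> Ob (AF C)" "V \<in> Ob (AF C)" "W \<in> Ob (AF C)"
    "f \<in> Hom (AF C) U V" "g \<in> Hom (AF C) V W"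
  then show "g \<cdot>\<^bsub>AF C\<^esub> f \<in> Hom (AF C) U W" by (simp add: AF_Comp_in_Hom)
next
  fix V W f assume "V \<in> Ob (AF C)" "W \<in> Ob (AF C)" "f \<in> Hom (AF C) V W"
  then have f: "arr C (Tot V) (Tot W) f" by (simp add: AF_HomD)
  show "f \<cdot>\<^bsub>AF C\<^esub> Idn (AF C) V = f" "Idn (AF C) W \<cdot>\<^bsub>AF C\<^esub> f = f"
    using comp_id[OF f] id_comp[OF f] by simp_all
next
  fix U V W X f g h
  assume "U \<in> Ob (AF C)" "V \<in> Ob (AF C)" "W \<in> Ob (AF C)" "X \<in> Ob (AF C)"
    "f \<in> Hom (AF C) U V" "g \<in> Hom (AF C) V W" "h \<in> Hom (AF C) W X"
  then show "h \<cdot>\<^bsub>AF C\<^esub> g \<cdot>\<^bsub>AF C\<^esub> f = h \<cdot>\<^bsub>AF C\<^esub> (g \<cdot>\<^bsub>AF C\<^esub> f)"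
    using assoc AF_HomD(1) by (metis AF_simps(1,3))
next
  fix U V W f g h
  assume "U \<in> Ob (AF C)" "V \<in> Ob (AF C)" "W \<in> Ob (AF C)"
    "f \<in> Hom (AF C) U V" "g \<in> Hom (AF C) U V" "h \<in> Hom (AF C) V W"
  then show "h \<cdot>\<^bsub>AF C\<^esub> Add (AF C) f g = Add (AF C) (h \<cdot>\<^bsub>AF C\<^esub> f) (h \<cdot>\<^bsub>AF C\<^esub> g)"
    using comp_add AF_HomD(1) by (metis AF_simps(1,3,4))
next
  fix U V W f g h
  assume "U \<in> Ob (AF C)" "V \<in> Ob (AF C)" "W \<in> Ob (AF C)"
    "f \<in> Hom (AF C) U V" "g \<in> Hom (AF C) V W" "h \<in> Hom (AF C) V W"
  then show "Add (AF C) g h \<cdot>\<^bsub>AF C\<^esub> f = Add (AF C) (g \<cdot>\<^bsub>AF C\<^esub> f) (h \<cdot>\<^bsub>AF C\<^esub> f)"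
    using add_comp AF_HomD(1) by (metis AF_simps(1,3,4))
qed


section \<open>Placed objects and restricted arrows\<close>

lemma iso_arrow_inverse:
  assumes "iso_arrow C X Y f" "X \<in> Ob C" "Y \<in> Ob C"
  obtains g where "arr C X Y f" "arr C Y X g" "g \<cdot>\<^bsub>C\<^esub> f = Idn C X" "f \<cdot>\<^bsub>C\<^esub> g = Idn C Y"
  using assms unfolding iso_arrow_def arr_def by blast

context abelian_category
begin

lemma zero_object_zero_ob: "zero_object C (zero_ob C)"
  unfolding zero_ob_def by (rule someI_ex[OF zero_object_exists])

lemma zero_ob_ob: "zero_ob C \<in> Ob C"
  using zero_object_zero_ob by (simp add: zero_object_def)

lemma placed_filtered:
  assumes X: "X \<in> Ob C"
  shows "filtered_object C (placed C X p)"
proof -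
  have z: "arr C (zero_ob C) X (Zero C (zero_ob C) X)" by (rule arr_zero[OF zero_ob_ob X])
  have zm: "monic C (zero_ob C) X (Zero C (zero_ob C) X)"
    unfolding monic_def
  proof (intro conjI ballI impI)
    fix Z u v assume "Z \<in> Ob C" "u \<in> Hom C Z (zero_ob C)" "v \<in> Hom C Z (zero_ob C)"
    then have "arr C Z (zero_ob C) u" "arr C Z (zero_ob C) v" using zero_ob_ob by (auto simp: arr_def)
    then show "u = v" using to_zero_object zero_object_zero_ob by metis
  qed (use z in \<open>simp add: arr_def\<close>)
  have im: "monic C X X (Idn C X)"
    unfolding monic_def
  proof (intro conjI ballI impI)
    fix Z u v assume "Z \<in> Ob C" "u \<in> Hom C Z X" "v \<in> Hom C Z X" "Idn C X \<cdot> u = Idn C X \<cdot> v"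
    then show "u = v" using Idn_Comp[OF _ X] by metis
  qed (rule Idn_in_Hom[OF X])
  have "\<exists>j\<in>Hom C (Fil (placed C X p) (i - 1)) (Fil (placed C X p) i).
      Inc (placed C X p) i \<cdot> j = Inc (placed C X p) (i - 1)" for i
  proof -
    consider "i < p" | "i = p" | "p < i" by linarith
    then show ?thesis
    proof cases
      case 1
      then show ?thesis using Idn_in_Hom[OF zero_ob_ob] comp_id[OF z] by (auto simp: placed_def)
    next
      case 2
      then show ?thesis using id_comp[OF z] z by (auto simp: placed_def arr_def)
    next
      case 3
      then show ?thesis using Idn_in_Hom[OF X] comp_id[OF arr_id[OF X]] by (auto simp: placed_def)
    qed
  qed
  moreover have "iso_arrow C X X (Idn C X)"
    using Idn_in_Hom[OF X] comp_id[OF arr_id[OF X]] by (auto simp: iso_arrow_def)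
  ultimately show ?thesis
    unfolding filtered_object_def
    using X zm im zero_ob_ob zero_object_zero_ob
    by (intro conjI exI[of _ "p - 1"] exI[of _ p] allI) (auto simp: placed_def)
qed

lemma restr_eq:
  assumes "monic C (Fil W p) (Tot W) (Inc W p)" "arr C (Fil V p) (Fil W p) g"
    "Inc W p \<cdot> g = f \<cdot> Inc V p"
  shows "restr C V W f p = g"
  unfolding restr_def
proof (rule the_equality)
  fix g' assume "g' \<in> Hom C (Fil V p) (Fil W p) \<and> Inc W p \<cdot> g' = f \<cdot> Inc V p"
  then show "g' = g" using assms by (intro monic_cancel[OF assms(1), of g' g]) (auto simp: arr_def)
qed (use assms in \<open>simp add: arr_def\<close>)

lemma restr_props:
  assumes V: "filtered_object C V" and W: "filtered_object C W" and f: "f \<in> Hom (AF C) V W"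
  shows "arr C (Fil V p) (Fil W p) (restr C V W f p)" and "Inc W p \<cdot> restr C V W f p = f \<cdot> Inc V p"
proof -
  interpret V: filtered_obj C V by (rule filtered_objI[OF V])
  interpret W: filtered_obj C W by (rule filtered_objI[OF W])
  obtain g where g: "arr C (Fil V p) (Fil W p) g" "Inc W p \<cdot> g = f \<cdot> Inc V p"
    using AF_HomD(2)[OF f V W] by blast
  then have "restr C V W f p = g" by (intro restr_eq W.Inc_monic)
  then show "arr C (Fil V p) (Fil W p) (restr C V W f p)" "Inc W p \<cdot> restr C V W f p = f \<cdot> Inc V p"
    using g by simp_all
qed

end


section \<open>Splitting a filtration by sections of its graded pieces\<close>

context filtered_obj
begin

text \<open>
  The retractions \<open>\<sigma> p\<close> of \<open>V\<close> onto the steps of its filtration have to be chosen coherently for the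
  arrows \<open>gr_proj C V p \<cdot> \<sigma> p\<close> to be the projections of a direct sum. Starting at an index \<open>N\<close> where
  the filtration is everything, \<open>\<sigma> (p - 1)\<close> is \<open>\<sigma> p\<close> followed by the retraction of \<open>Fil V p\<close> onto
  \<open>Fil V (p - 1)\<close> that kills \<open>s p\<close>. Then the idempotents \<open>Inc V p \<cdot> \<sigma> p\<close> of \<open>V\<close> drop by the \<open>p\<close>-th
  summand from \<open>p\<close> to \<open>p - 1\<close>, and each \<open>\<sigma> i\<close> kills all summands of index above \<open>i\<close>.
\<close>

lemma compatible_retractions:
  assumes s: "\<And>p. arr C (gr C V p) (Fil V p) (s p)"
    and qs: "\<And>p. gr_proj C V p \<cdot> s p = Idn C (gr C V p)"
    and N: "iso_arrow C (Fil V N) (Tot V) (Inc V N)"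
  obtains \<sigma> where "\<And>p. p \<le> N \<Longrightarrow> arr C (Tot V) (Fil V p) (\<sigma> p)"
    and "\<And>p. p \<le> N \<Longrightarrow> \<sigma> p \<cdot> Inc V p = Idn C (Fil V p)"
    and "Inc V N \<cdot> \<sigma> N = Idn C (Tot V)"
    and "\<And>p. p \<le> N \<Longrightarrow> Inc V p \<cdot> \<sigma> p
      = Add C ((Inc V p \<cdot> s p) \<cdot> (gr_proj C V p \<cdot> \<sigma> p)) (Inc V (p - 1) \<cdot> \<sigma> (p - 1))"
    and "\<And>p i. \<lbrakk>p \<le> N; i < p\<rbrakk> \<Longrightarrow> \<sigma> i \<cdot> (Inc V p \<cdot> s p) = Zero C (gr C V p) (Fil V i)"
proof -
  have "\<forall>p. \<exists>t. arr C (Fil V p) (Fil V (p - 1)) t \<and> t \<cdot> step C V p = Idn C (Fil V (p - 1)) \<and>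
    Add C (step C V p \<cdot> t) (s p \<cdot> gr_proj C V p) = Idn C (Fil V p) \<and>
    t \<cdot> s p = Zero C (gr C V p) (Fil V (p - 1))"
    using retraction_of_section[OF s qs] by metis
  then obtain \<tau> where \<tau>: "\<And>p. arr C (Fil V p) (Fil V (p - 1)) (\<tau> p)"
    and \<tau>_step: "\<And>p. \<tau> p \<cdot> step C V p = Idn C (Fil V (p - 1))"
    and \<tau>_add: "\<And>p. Add C (step C V p \<cdot> \<tau> p) (s p \<cdot> gr_proj C V p) = Idn C (Fil V p)"
    and \<tau>_s: "\<And>p. \<tau> p \<cdot> s p = Zero C (gr C V p) (Fil V (p - 1))"
    by metis
  obtain \<sigma>N where \<sigma>N: "arr C (Tot V) (Fil V N) \<sigma>N" "\<sigma>N \<cdot> Inc V N = Idn C (Fil V N)"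
    "Inc V N \<cdot> \<sigma>N = Idn C (Tot V)"
    using iso_arrow_inverse[OF N Fil_ob Tot_ob] by blast
  define \<sigma> where "\<sigma> p = rec_nat \<sigma>N (\<lambda>n x. \<tau> (N - int n) \<cdot> x) (nat (N - p))" for p
  have \<sigma>_N: "\<sigma> N = \<sigma>N" by (simp add: \<sigma>_def)
  have \<sigma>_pred: "\<sigma> (p - 1) = \<tau> p \<cdot> \<sigma> p" if "p \<le> N" for p
  proof -
    have "nat (N - (p - 1)) = Suc (nat (N - p))" "N - int (nat (N - p)) = p" using that by simp_all
    then show ?thesis by (simp add: \<sigma>_def)
  qed
  have \<sigma>: "arr C (Tot V) (Fil V p) (\<sigma> p)" if "p \<le> N" for p
    using that
  proof (induction p rule: int_le_induct)
    case base
    then show ?case using \<sigma>N \<sigma>_N by simp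
  next
    case (step p)
    then show ?case using arr_comp[OF step.IH \<tau>] \<sigma>_pred by simp
  qed
  have \<sigma>_Inc: "\<sigma> p \<cdot> Inc V p = Idn C (Fil V p)" if "p \<le> N" for p
    using that
  proof (induction p rule: int_le_induct)
    case base
    then show ?case using \<sigma>N \<sigma>_N by simp
  next
    case (step p)
    have Is: "arr C (Fil V (p - 1)) (Tot V) (Inc V p \<cdot> step C V p)"
      by (rule arr_comp[OF step_arr Inc_arr])
    have "\<sigma> (p - 1) \<cdot> Inc V (p - 1) = (\<tau> p \<cdot> \<sigma> p) \<cdot> (Inc V p \<cdot> step C V p)"
      using \<sigma>_pred[OF step.hyps] Inc_step by simp
    also have "\<dots> = \<tau> p \<cdot> (\<sigma> p \<cdot> (Inc V p \<cdot> step C V p))"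
      by (rule assoc[OF Is \<sigma>[OF step.hyps] \<tau>])
    also have "\<dots> = \<tau> p \<cdot> ((\<sigma> p \<cdot> Inc V p) \<cdot> step C V p)"
      by (simp add: assoc[OF step_arr Inc_arr \<sigma>[OF step.hyps]])
    also have "\<dots> = Idn C (Fil V (p - 1))" using step.IH id_comp[OF step_arr] \<tau>_step by simp
    finally show ?case .
  qed
  have decomp: "Inc V p \<cdot> \<sigma> p
      = Add C ((Inc V p \<cdot> s p) \<cdot> (gr_proj C V p \<cdot> \<sigma> p)) (Inc V (p - 1) \<cdot> \<sigma> (p - 1))"
    if p: "p \<le> N" for p
  proof -
    note \<sigma>p = \<sigma>[OF p]
    let ?a = "step C V p \<cdot> \<tau> p" and ?b = "s p \<cdot> gr_proj C V p"
    have a: "arr C (Fil V p) (Fil V p) ?a" by (rule arr_comp[OF \<tau> step_arr])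
    have b: "arr C (Fil V p) (Fil V p) ?b" by (rule arr_comp[OF proj_arr s])
    note a\<sigma> = arr_comp[OF \<sigma>p a] and b\<sigma> = arr_comp[OF \<sigma>p b]
    have "Inc V p \<cdot> \<sigma> p = Inc V p \<cdot> (Add C ?a ?b \<cdot> \<sigma> p)" using \<tau>_add id_comp[OF \<sigma>p] by simp
    also have "\<dots> = Add C (Inc V p \<cdot> (?a \<cdot> \<sigma> p)) (Inc V p \<cdot> (?b \<cdot> \<sigma> p))"
      using add_comp[OF \<sigma>p a b] comp_add[OF a\<sigma> b\<sigma> Inc_arr] by simp
    also have "\<dots> = Add C (Inc V p \<cdot> (?b \<cdot> \<sigma> p)) (Inc V p \<cdot> (?a \<cdot> \<sigma> p))"
      by (rule add_commute[OF arr_comp[OF a\<sigma> Inc_arr] arr_comp[OF b\<sigma> Inc_arr]])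
    also have "Inc V p \<cdot> (?b \<cdot> \<sigma> p) = (Inc V p \<cdot> s p) \<cdot> (gr_proj C V p \<cdot> \<sigma> p)"
      by (simp add: assoc[OF \<sigma>p proj_arr s] assoc[OF arr_comp[OF \<sigma>p proj_arr] s Inc_arr])
    also have "Inc V p \<cdot> (?a \<cdot> \<sigma> p) = (Inc V p \<cdot> step C V p) \<cdot> (\<tau> p \<cdot> \<sigma> p)"
      by (simp add: assoc[OF \<sigma>p \<tau> step_arr] assoc[OF arr_comp[OF \<sigma>p \<tau>] step_arr Inc_arr])
    also have "\<dots> = Inc V (p - 1) \<cdot> \<sigma> (p - 1)" using \<sigma>_pred[OF p] Inc_step by simp
    finally show ?thesis .
  qed
  have orth: "\<sigma> i \<cdot> (Inc V p \<cdot> s p) = Zero C (gr C V p) (Fil V i)" if p: "p \<le> N" and i: "i < p" for p i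
  proof -
    have Is: "arr C (gr C V p) (Tot V) (Inc V p \<cdot> s p)" by (rule arr_comp[OF s Inc_arr])
    have "i \<le> p - 1" using i by simp
    then show ?thesis
    proof (induction i rule: int_le_induct)
      case base
      have "\<sigma> (p - 1) \<cdot> (Inc V p \<cdot> s p) = \<tau> p \<cdot> ((\<sigma> p \<cdot> Inc V p) \<cdot> s p)"
        using \<sigma>_pred[OF p] assoc[OF Is \<sigma>[OF p] \<tau>] assoc[OF s Inc_arr \<sigma>[OF p]] by simp
      then show ?case using \<sigma>_Inc[OF p] id_comp[OF s] \<tau>_s by simp
    next
      case (step i)
      then have i: "i \<le> N" using p by simp
      have "\<sigma> (i - 1) \<cdot> (Inc V p \<cdot> s p) = \<tau> i \<cdot> (\<sigma> i \<cdot> (Inc V p \<cdot> s p))"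
        using \<sigma>_pred[OF i] assoc[OF Is \<sigma>[OF i] \<tau>] by simp
      then show ?case using step.IH comp_zero[OF \<tau> gr_ob] by simp
    qed
  qed
  show thesis using that[OF \<sigma> \<sigma>_Inc _ decomp orth] \<sigma>_N \<sigma>N(3) by simp
qed

lemma section_AF:
  assumes s: "arr C (gr C V p) (Fil V p) s"
  shows "Inc V p \<cdot> s \<in> Hom (AF C) (placed C (gr C V p) p) V"
proof (rule AF_HomI)
  show "arr C (Tot (placed C (gr C V p) p)) (Tot V) (Inc V p \<cdot> s)"
    using arr_comp[OF s Inc_arr] by (simp add: placed_def)
  fix i
  show "\<exists>g. arr C (Fil (placed C (gr C V p) p) i) (Fil V i) g \<and>
    Inc V i \<cdot> g = (Inc V p \<cdot> s) \<cdot> Inc (placed C (gr C V p) p) i"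
  proof (cases "i < p")
    case True
    then show ?thesis
      using arr_zero[OF zero_ob_ob Fil_ob] comp_zero[OF Inc_arr zero_ob_ob]
        comp_zero[OF arr_comp[OF s Inc_arr] zero_ob_ob]
      by (auto simp: placed_def)
  next
    case False
    then obtain j where j: "arr C (Fil V p) (Fil V i) j" "Inc V i \<cdot> j = Inc V p"
      using Fil_mono[of p i] by auto
    have "Inc V i \<cdot> (j \<cdot> s) = Inc V p \<cdot> s" using assoc[OF s j(1) Inc_arr] j(2) by simp
    then show ?thesis
      using False arr_comp[OF s j(1)] comp_id[OF arr_comp[OF s Inc_arr]] by (auto simp: placed_def)
  qed
qed

lemma projection_kills_lower:
  assumes \<pi>: "arr C (Tot V) (gr C V p) \<pi>" and \<pi>_Inc: "\<pi> \<cdot> Inc V p = gr_proj C V p" and "i < p"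
  shows "\<pi> \<cdot> Inc V i = Zero C (Fil V i) (gr C V p)"
proof -
  obtain j where j: "arr C (Fil V i) (Fil V (p - 1)) j" "Inc V (p - 1) \<cdot> j = Inc V i"
    using Fil_mono[of i "p - 1"] \<open>i < p\<close> by auto
  have "\<pi> \<cdot> Inc V (p - 1) = (\<pi> \<cdot> Inc V p) \<cdot> step C V p"
    by (simp add: assoc[OF step_arr Inc_arr \<pi>] Inc_step)
  then have "\<pi> \<cdot> Inc V (p - 1) = Zero C (Fil V (p - 1)) (gr C V p)"
    using \<pi>_Inc proj_step by simp
  then show ?thesis
    using assoc[OF j(1) Inc_arr \<pi>] j(2) zero_comp[OF j(1) gr_ob] by simp
qed

lemma projection_AF:
  assumes \<pi>: "arr C (Tot V) (gr C V p) \<pi>" and \<pi>_Inc: "\<pi> \<cdot> Inc V p = gr_proj C V p"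
  shows "\<pi> \<in> Hom (AF C) V (placed C (gr C V p) p)"
proof (rule AF_HomI)
  show "arr C (Tot V) (Tot (placed C (gr C V p) p)) \<pi>" using \<pi> by (simp add: placed_def)
  fix i
  show "\<exists>g. arr C (Fil V i) (Fil (placed C (gr C V p) p) i) g \<and>
    Inc (placed C (gr C V p) p) i \<cdot> g = \<pi> \<cdot> Inc V i"
  proof (cases "i < p")
    case True
    then show ?thesis
      using arr_zero[OF Fil_ob zero_ob_ob] projection_kills_lower[OF \<pi> \<pi>_Inc]
        zero_comp[OF arr_zero[OF Fil_ob zero_ob_ob] gr_ob]
      by (intro exI[of _ "Zero C (Fil V i) (zero_ob C)"]) (simp add: placed_def)
  next
    case False
    then show ?thesis using arr_comp[OF Inc_arr \<pi>] id_comp[OF arr_comp[OF Inc_arr \<pi>]]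
      by (auto simp: placed_def)
  qed
qed

text \<open>
  If all quotients onto graded pieces split, \<open>V\<close> itself is a direct sum of its graded pieces, with
  injections \<open>Inc V p \<cdot> s p\<close> and projections \<open>gr_proj C V p \<cdot> \<sigma> p\<close>. The idempotents \<open>Inc V p \<cdot> \<sigma> p\<close>
  telescope: they are the identity for large \<open>p\<close> and zero for small \<open>p\<close>, and their successive
  differences are the summands \<open>\<iota> p \<cdot> \<pi> p\<close>. Those with \<open>p\<close> outside \<open>[a, b]\<close> vanish by the type
  condition.
\<close>

lemma graded_sum_of_sections:
  assumes s: "\<And>p. arr C (gr C V p) (Fil V p) (s p)"
    and qs: "\<And>p. gr_proj C V p \<cdot> s p = Idn C (gr C V p)"
    and type: "has_type C V a b"
  obtains \<iota> \<pi> where "is_graded_sum C V a b V \<iota> \<pi>"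
    and "\<And>p. p \<in> {a..b} \<Longrightarrow> \<pi> p \<cdot> Inc V p = gr_proj C V p"
proof -
  interpret P: preadditive_category "AF C" by (rule preadditive_AF)
  obtain N :: nat where iso: "iso_arrow C (Fil V (int N)) (Tot V) (Inc V (int N))"
    and bot: "zero_object C (Fil V (- int N))" and MN: "nat \<bar>a\<bar> + nat \<bar>b\<bar> + 1 \<le> N"
    using filtration_bound[of "nat \<bar>a\<bar> + nat \<bar>b\<bar> + 1"] by (metis order_refl)
  obtain \<sigma> where \<sigma>: "\<And>p. p \<le> int N \<Longrightarrow> arr C (Tot V) (Fil V p) (\<sigma> p)"
    and \<sigma>_Inc: "\<And>p. p \<le> int N \<Longrightarrow> \<sigma> p \<cdot> Inc V p = Idn C (Fil V p)"
    and \<sigma>_N: "Inc V (int N) \<cdot> \<sigma> (int N) = Idn C (Tot V)"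
    and decomp: "\<And>p. p \<le> int N \<Longrightarrow> Inc V p \<cdot> \<sigma> p
      = Add C ((Inc V p \<cdot> s p) \<cdot> (gr_proj C V p \<cdot> \<sigma> p)) (Inc V (p - 1) \<cdot> \<sigma> (p - 1))"
    and orth: "\<And>p i. \<lbrakk>p \<le> int N; i < p\<rbrakk> \<Longrightarrow> \<sigma> i \<cdot> (Inc V p \<cdot> s p) = Zero C (gr C V p) (Fil V i)"
    using compatible_retractions[OF s qs iso] by blast
  define \<iota> where "\<iota> p = Inc V p \<cdot> s p" for p
  define \<pi> where "\<pi> p = gr_proj C V p \<cdot> \<sigma> p" for p
  have \<iota>: "arr C (gr C V p) (Tot V) (\<iota> p)" for p
    unfolding \<iota>_def by (rule arr_comp[OF s Inc_arr])
  have \<pi>: "arr C (Tot V) (gr C V p) (\<pi> p)" if "p \<le> int N" for p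
    unfolding \<pi>_def by (rule arr_comp[OF \<sigma>[OF that] proj_arr])
  have \<pi>_Inc: "\<pi> p \<cdot> Inc V p = gr_proj C V p" if "p \<le> int N" for p
    unfolding \<pi>_def using assoc[OF Inc_arr \<sigma>[OF that] proj_arr] \<sigma>_Inc[OF that] comp_id[OF proj_arr]
    by simp
  have \<pi>_\<iota>: "\<pi> j \<cdot> \<iota> i = (if i = j then Idn C (gr C V i) else Zero C (gr C V i) (gr C V j))"
    if i: "i \<le> int N" and j: "j \<le> int N" for i j
  proof -
    have eq: "\<pi> j \<cdot> \<iota> i = (\<pi> j \<cdot> Inc V i) \<cdot> s i"
      unfolding \<iota>_def by (rule assoc[OF s Inc_arr \<pi>[OF j], symmetric])
    consider "i = j" | "i < j" | "j < i" by linarith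
    then show ?thesis
    proof cases
      case 1
      then show ?thesis using eq \<pi>_Inc[OF j] qs by simp
    next
      case 2
      then show ?thesis
        using eq projection_kills_lower[OF \<pi>[OF j] \<pi>_Inc[OF j]] zero_comp[OF s gr_ob] by simp
    next
      case 3
      then show ?thesis
        unfolding \<pi>_def using assoc[OF \<iota> \<sigma>[OF j] proj_arr] orth[OF i 3] comp_zero[OF proj_arr gr_ob]
        by (simp add: \<iota>_def)
    qed
  qed
  have Vob: "V \<in> Ob (AF C)" using filtered by simp
  have plob: "placed C (gr C V p) p \<in> Ob (AF C)" for p using placed_filtered[OF gr_ob] by simp
  have \<iota>AF: "\<iota> p \<in> Hom (AF C) (placed C (gr C V p) p) V" for p
    unfolding \<iota>_def by (rule section_AF[OF s])
  have \<pi>AF: "\<pi> p \<in> Hom (AF C) V (placed C (gr C V p) p)" if "p \<le> int N" for p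
    by (rule projection_AF[OF \<pi>[OF that] \<pi>_Inc[OF that]])
  have summand: "arr (AF C) V V (\<iota> p \<cdot> \<pi> p)" if "p \<le> int N" for p
    using AF_Comp_in_Hom[OF _ placed_filtered[OF gr_ob] _ \<pi>AF[OF that] \<iota>AF] filtered
    by (simp add: arr_def)
  let ?S = "\<lambda>I. finprod (hom_grp (AF C) V V) (\<lambda>p. \<iota> p \<cdot> \<pi> p) I"
  have partial: "p \<le> int N \<longrightarrow> Inc V p \<cdot> \<sigma> p = ?S {- int N + 1..p}" if "- int N \<le> p" for p
    using that
  proof (induction p rule: int_ge_induct)
    case base
    have "\<sigma> (- int N) = Zero C (Tot V) (Fil V (- int N))" using to_zero_object[OF \<sigma> bot] by simp
    then show ?case by (simp add: P.sum_empty[OF Vob Vob] comp_zero[OF Inc_arr Tot_ob])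
  next
    case (step p)
    have ins: "{- int N + 1..p + 1} = insert (p + 1) {- int N + 1..p}" using step.hyps by auto
    show ?case
    proof
      assume p: "p + 1 \<le> int N"
      have "?S {- int N + 1..p + 1} = Add C (\<iota> (p + 1) \<cdot> \<pi> (p + 1)) (?S {- int N + 1..p})"
        unfolding ins by (rule P.sum_insert[OF Vob Vob, unfolded AF_simps]) (use summand p in auto)
      then show "Inc V (p + 1) \<cdot> \<sigma> (p + 1) = ?S {- int N + 1..p + 1}"
        using decomp[OF p] step.IH p by (simp add: \<iota>_def \<pi>_def)
    qed
  qed
  have "\<iota> p \<cdot> \<pi> p = Zero (AF C) V V" if "p \<notin> {a..b}" "p \<le> int N" for p
    using to_zero_object[OF \<pi>[OF that(2)]] type that(1) comp_zero[OF \<iota> Tot_ob]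
    by (simp add: has_type_def)
  then have outside: "\<iota> p \<cdot> \<pi> p = \<one>\<^bsub>hom_grp (AF C) V V\<^esub>" if "p \<in> {- int N + 1..int N} - {a..b}" for p
    using that by (simp add: hom_grp_def)
  have inside: "{a..b} \<subseteq> {- int N + 1..int N}" using MN by auto
  have summands: "(\<lambda>p. \<iota> p \<cdot> \<pi> p) \<in> {- int N + 1..int N} \<rightarrow> carrier (hom_grp (AF C) V V)"
    using summand by (auto simp: hom_grp_def arr_def)
  interpret H: comm_group "hom_grp (AF C) V V" by (rule P.comm_group_Hom[OF Vob Vob])
  have "?S {a..b} = ?S {- int N + 1..int N}"
    by (rule H.finprod_mono_neutral_cong_left[OF _ inside outside refl summands]) simp_all
  also have "\<dots> = Idn C (Tot V)" using partial[of "int N"] \<sigma>_N by simp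
  finally have sum: "?S {a..b} = Idn C (Tot V)" .
  have le: "p \<le> int N" if "p \<in> {a..b}" for p using that MN by auto
  have "is_graded_sum C V a b V \<iota> \<pi>"
    unfolding is_graded_sum_def direct_sum_def
    using sum Vob plob \<iota>AF \<pi>AF[OF le] \<pi>_\<iota>[OF le le] by (simp add: placed_def)
  then show thesis using that \<pi>_Inc le by blast
qed

text \<open>
  The comparison isomorphism \<open>\<phi>\<close> of the two direct sums satisfies \<open>\<pi>' p \<cdot> \<phi> = \<pi> p\<close>. It carries \<open>Fil W p\<close>
  into \<open>Fil V p\<close>, where \<open>\<pi>' p\<close> is the quotient arrow, so on \<open>Fil W p\<close> this equation says that \<open>\<phi>\<close>
  induces the identity on the \<open>p\<close>-th graded piece.
\<close>

lemma good_splitting_of_graded_sums: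
  assumes ds: "is_graded_sum C V a b W \<iota> \<pi>" and ds': "is_graded_sum C V a b V \<iota>' \<pi>'"
    and \<pi>'_Inc: "\<And>p. p \<in> {a..b} \<Longrightarrow> \<pi>' p \<cdot> Inc V p = gr_proj C V p"
  shows "\<exists>\<phi>. good_splitting C V a b W \<pi> \<phi>"
proof -
  interpret P: preadditive_category "AF C" by (rule preadditive_AF)
  note ds = ds[unfolded is_graded_sum_def] and ds' = ds'[unfolded is_graded_sum_def]
  obtain \<phi> where iso: "iso_arrow (AF C) W V \<phi>"
    and comp: "\<And>p. p \<in> {a..b} \<Longrightarrow> \<pi>' p \<cdot> \<phi> = \<pi> p"
    using P.direct_sum_unique[OF ds ds'] by auto
  have W: "filtered_object C W" using ds by (simp add: direct_sum_def)
  interpret W: filtered_obj C W by (rule filtered_objI[OF W])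
  have \<phi>AF: "\<phi> \<in> Hom (AF C) W V" using iso by (simp add: iso_arrow_def)
  note \<phi> = AF_HomD(1)[OF \<phi>AF W filtered]
  have "descend C (gr C V p) (gr C V p) (\<pi> p \<cdot> Inc W p)
      (gr_proj C V p \<cdot> restr C W V \<phi> p) = Idn C (gr C V p)" if p: "p \<in> {a..b}" for p
  proof -
    let ?X = "gr C V p" and ?P = "placed C (gr C V p) p"
    have Pl: "filtered_object C ?P" by (rule placed_filtered[OF gr_ob])
    have \<iota>AF: "\<iota> p \<in> Hom (AF C) ?P W" and \<pi>AF: "\<pi> p \<in> Hom (AF C) W ?P"
      and \<pi>'AF: "\<pi>' p \<in> Hom (AF C) V ?P" and \<pi>\<iota>: "\<pi> p \<cdot> \<iota> p = Idn C ?X"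
      using ds ds' p by (simp_all add: direct_sum_def placed_def)
    have \<pi>: "arr C (Tot W) ?X (\<pi> p)" and \<pi>': "arr C (Tot V) ?X (\<pi>' p)" and \<iota>: "arr C ?X (Tot W) (\<iota> p)"
      using AF_HomD(1)[OF \<pi>AF W Pl] AF_HomD(1)[OF \<pi>'AF filtered Pl] AF_HomD(1)[OF \<iota>AF Pl W]
      by (simp_all add: placed_def)
    note restr = restr_props[OF W filtered \<phi>AF]
    have "gr_proj C V p \<cdot> restr C W V \<phi> p = \<pi>' p \<cdot> (Inc V p \<cdot> restr C W V \<phi> p)"
      by (simp add: \<pi>'_Inc[OF p, symmetric] assoc[OF restr(1) Inc_arr \<pi>'])
    also have "\<dots> = \<pi> p \<cdot> Inc W p"
      by (simp add: restr(2) assoc[OF W.Inc_arr \<phi> \<pi>', symmetric] comp[OF p])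
    finally have h: "gr_proj C V p \<cdot> restr C W V \<phi> p = \<pi> p \<cdot> Inc W p" .
    obtain u where u: "arr C ?X (Fil W p) u" "Inc W p \<cdot> u = \<iota> p"
      using AF_HomD(2)[OF \<iota>AF Pl W, of p] comp_id[OF \<iota>] by (auto simp: placed_def)
    have q: "arr C (Fil W p) ?X (\<pi> p \<cdot> Inc W p)" by (rule arr_comp[OF W.Inc_arr \<pi>])
    \<comment> \<open>the quotient arrow of \<open>W\<close> is split by \<open>u\<close>, hence an induced arrow is unique\<close>
    have qu: "(\<pi> p \<cdot> Inc W p) \<cdot> u = Idn C ?X" using assoc[OF u(1) W.Inc_arr \<pi>] u(2) \<pi>\<iota> by simp
    show ?thesis
      unfolding descend_def h
    proof (rule the_equality)
      show "Idn C ?X \<in> Hom C ?X ?X \<and> Idn C ?X \<cdot> (\<pi> p \<cdot> Inc W p) = \<pi> p \<cdot> Inc W p"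
        using Idn_in_Hom[OF gr_ob] id_comp[OF q] by simp
    next
      fix g assume "g \<in> Hom C ?X ?X \<and> g \<cdot> (\<pi> p \<cdot> Inc W p) = \<pi> p \<cdot> Inc W p"
      then have g: "arr C ?X ?X g" and eq: "g \<cdot> (\<pi> p \<cdot> Inc W p) = \<pi> p \<cdot> Inc W p"
        using gr_ob by (simp_all add: arr_def)
      then show "g = Idn C ?X" using assoc[OF u(1) q g] qu comp_id[OF g] by simp
    qed
  qed
  then show ?thesis using iso by (auto simp: good_splitting_def splitting_def)
qed

end


section \<open>Fully faithful additive functors\<close>

text \<open>
  The properties of the shift that the splitting uses. They are closed under composition, which makes
  them available for the iterates of the shift.
\<close>

locale full_embedding = preadditive_category +
  fixes G :: "('a, 'b) functor_data"
  assumes map_arr: "arr C X Y f \<Longrightarrow> arr C (FOb G X) (FOb G Y) (FHom G f)"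
    and map_id: "X \<in> Ob C \<Longrightarrow> FHom G (Idn C X) = Idn C (FOb G X)"
    and map_comp: "\<lbrakk>arr C X Y f; arr C Y Z g\<rbrakk> \<Longrightarrow> FHom G (g \<cdot> f) = FHom G g \<cdot> FHom G f"
    and map_zero: "\<lbrakk>X \<in> Ob C; Y \<in> Ob C\<rbrakk> \<Longrightarrow> FHom G (Zero C X Y) = Zero C (FOb G X) (FOb G Y)"
    and full: "\<lbrakk>arr C (FOb G X) (FOb G Y) g; X \<in> Ob C; Y \<in> Ob C\<rbrakk> \<Longrightarrow> \<exists>f. arr C X Y f \<and> FHom G f = g"
    and faithful: "\<lbrakk>FHom G f = FHom G f'; arr C X Y f; arr C X Y f'\<rbrakk> \<Longrightarrow> f = f'"
    and map_monic: "\<lbrakk>monic C X Y f; X \<in> Ob C; Y \<in> Ob C\<rbrakk> \<Longrightarrow> monic C (FOb G X) (FOb G Y) (FHom G f)"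
begin

lemma map_ob: "X \<in> Ob C \<Longrightarrow> FOb G X \<in> Ob C"
  using map_arr[OF arr_id] by (simp add: arr_def)

end

text \<open>
  An invertible unit conjugates \<open>f\<close> into \<open>S (R f)\<close>, so \<open>f\<close> is recovered from \<open>R f\<close>.
\<close>

lemma (in category) faithful_of_unit:
  assumes S: "endofunctor C S" and R: "endofunctor C R"
    and \<eta>: "\<And>X. X \<in> Ob C \<Longrightarrow> iso_arrow C X (FOb S (FOb R X)) (\<eta> X)"
    and nat: "\<And>X Y f. arr C X Y f \<Longrightarrow> \<eta> Y \<cdot> f = FHom S (FHom R f) \<cdot> \<eta> X"
    and eq: "FHom R f = FHom R f'" and f: "arr C X Y f" and f': "arr C X Y f'"
  shows "f = f'"
proof -
  have X: "X \<in> Ob C" and Y: "Y \<in> Ob C" using f by (simp_all add: arr_def)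
  have Y': "FOb S (FOb R Y) \<in> Ob C" using S R Y by (simp add: endofunctor_def)
  obtain g where \<eta>Y: "arr C Y (FOb S (FOb R Y)) (\<eta> Y)" and g: "arr C (FOb S (FOb R Y)) Y g"
    and "g \<cdot> \<eta> Y = Idn C Y"
    using iso_arrow_inverse[OF \<eta>[OF Y] Y Y'] by blast
  moreover have "g \<cdot> (\<eta> Y \<cdot> f) = g \<cdot> (\<eta> Y \<cdot> f')" using nat[OF f] nat[OF f'] eq by simp
  ultimately show ?thesis
    by (simp add: assoc[OF f \<eta>Y g, symmetric] assoc[OF f' \<eta>Y g, symmetric] id_comp[OF f] id_comp[OF f'])
qed

text \<open>
  The same for an invertible counit. It gives the faithfulness of the quasi-inverse \<open>S\<close>, on which
  the fullness of \<open>R\<close> depends.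
\<close>

lemma (in category) faithful_of_counit:
  assumes S: "endofunctor C S" and R: "endofunctor C R"
    and \<epsilon>: "\<And>X. X \<in> Ob C \<Longrightarrow> iso_arrow C (FOb R (FOb S X)) X (\<epsilon> X)"
    and nat: "\<And>X Y f. arr C X Y f \<Longrightarrow> \<epsilon> Y \<cdot> FHom R (FHom S f) = f \<cdot> \<epsilon> X"
    and eq: "FHom S f = FHom S f'" and f: "arr C X Y f" and f': "arr C X Y f'"
  shows "f = f'"
proof -
  have X: "X \<in> Ob C" and Y: "Y \<in> Ob C" using f by (simp_all add: arr_def)
  have X': "FOb R (FOb S X) \<in> Ob C" using S R X by (simp add: endofunctor_def)
  obtain g where \<epsilon>X: "arr C (FOb R (FOb S X)) X (\<epsilon> X)" and g: "arr C X (FOb R (FOb S X)) g"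
    and "\<epsilon> X \<cdot> g = Idn C X"
    using iso_arrow_inverse[OF \<epsilon>[OF X] X' X] by blast
  moreover have "(f \<cdot> \<epsilon> X) \<cdot> g = (f' \<cdot> \<epsilon> X) \<cdot> g"
    using nat[OF f] nat[OF f'] eq by simp
  ultimately show ?thesis
    by (simp add: assoc[OF g \<epsilon>X f] assoc[OF g \<epsilon>X f'] comp_id[OF f] comp_id[OF f'])
qed

lemma (in preadditive_category) full_embedding_shift:
  assumes "shift_functor C T"
  shows "full_embedding C T"
proof -
  have T: "endofunctor C T" and add: "additive_functor C T"
    using assms by (simp_all add: shift_functor_def autoequivalence_def)
  obtain S \<eta> \<epsilon> where S: "endofunctor C S" and \<eta>0: "natural_iso C id_functor (comp_functor S T) \<eta>"
    and \<epsilon>0: "natural_iso C (comp_functor T S) id_functor \<epsilon>"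
    using assms by (auto simp: shift_functor_def autoequivalence_def)
  have Tarr: "arr C (FOb T X) (FOb T Y) (FHom T f)" if "arr C X Y f" for X Y f
    using T that by (simp add: endofunctor_def arr_def)
  have Sarr: "arr C (FOb S X) (FOb S Y) (FHom S f)" if "arr C X Y f" for X Y f
    using S that by (simp add: endofunctor_def arr_def)
  have Tob: "FOb T X \<in> Ob C" and Sob: "FOb S X \<in> Ob C" if "X \<in> Ob C" for X
    using S T that by (simp_all add: endofunctor_def)
  have Tcomp: "FHom T (g \<cdot> f) = FHom T g \<cdot> FHom T f" if "arr C X Y f" "arr C Y Z g" for X Y Z f g
    using T that unfolding endofunctor_def arr_def by blast
  have \<eta>: "iso_arrow C X (FOb S (FOb T X)) (\<eta> X)" if "X \<in> Ob C" for X
    using \<eta>0 that by (simp add: natural_iso_def id_functor_def comp_functor_def)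
  have \<epsilon>: "iso_arrow C (FOb T (FOb S X)) X (\<epsilon> X)" if "X \<in> Ob C" for X
    using \<epsilon>0 that by (simp add: natural_iso_def id_functor_def comp_functor_def)
  have \<eta>nat: "\<eta> Y \<cdot> f = FHom S (FHom T f) \<cdot> \<eta> X" if "arr C X Y f" for X Y f
    using \<eta>0 that by (simp add: natural_iso_def id_functor_def comp_functor_def arr_def)
  have \<epsilon>nat: "\<epsilon> Y \<cdot> FHom T (FHom S f) = f \<cdot> \<epsilon> X" if "arr C X Y f" for X Y f
    using \<epsilon>0 that by (simp add: natural_iso_def id_functor_def comp_functor_def arr_def)
  note Tfaithful = faithful_of_unit[OF S T \<eta> \<eta>nat]
  note Sfaithful = faithful_of_counit[OF S T \<epsilon> \<epsilon>nat]
  have Tfull: "\<exists>f. arr C X Y f \<and> FHom T f = g"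
    if g: "arr C (FOb T X) (FOb T Y) g" and X: "X \<in> Ob C" and Y: "Y \<in> Ob C" for X Y g
  proof -
    obtain \<eta>X' where \<eta>X: "arr C X (FOb S (FOb T X)) (\<eta> X)" "arr C (FOb S (FOb T X)) X \<eta>X'"
      "\<eta> X \<cdot> \<eta>X' = Idn C (FOb S (FOb T X))"
      using iso_arrow_inverse[OF \<eta>[OF X] X Sob[OF Tob[OF X]]] by blast
    obtain \<eta>Y' where \<eta>Y: "arr C Y (FOb S (FOb T Y)) (\<eta> Y)" "arr C (FOb S (FOb T Y)) Y \<eta>Y'"
      "\<eta> Y \<cdot> \<eta>Y' = Idn C (FOb S (FOb T Y))"
      using iso_arrow_inverse[OF \<eta>[OF Y] Y Sob[OF Tob[OF Y]]] by blast
    \<comment> \<open>the arrow \<open>S g\<close> conjugated by the unit; its image under \<open>S T\<close> is \<open>S g\<close>\<close>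
    let ?h = "FHom S g \<cdot> \<eta> X" and ?f = "\<eta>Y' \<cdot> (FHom S g \<cdot> \<eta> X)"
    have h: "arr C X (FOb S (FOb T Y)) ?h" by (rule arr_comp[OF \<eta>X(1) Sarr[OF g]])
    have f: "arr C X Y ?f" by (rule arr_comp[OF h \<eta>Y(2)])
    note Tf = Tarr[OF f]
    have "FHom S (FHom T ?f) \<cdot> \<eta> X = \<eta> Y \<cdot> ?f" by (rule \<eta>nat[OF f, symmetric])
    also have "\<dots> = ?h" using assoc[OF h \<eta>Y(2,1)] \<eta>Y(3) id_comp[OF h] by simp
    finally have eq: "FHom S (FHom T ?f) \<cdot> \<eta> X = FHom S g \<cdot> \<eta> X" .
    then have "(FHom S (FHom T ?f) \<cdot> \<eta> X) \<cdot> \<eta>X' = (FHom S g \<cdot> \<eta> X) \<cdot> \<eta>X'" by simp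
    then have "FHom S (FHom T ?f) = FHom S g"
      using assoc[OF \<eta>X(2,1) Sarr[OF Tf]] assoc[OF \<eta>X(2,1) Sarr[OF g]] \<eta>X(3)
        comp_id[OF Sarr[OF Tf]] comp_id[OF Sarr[OF g]] by simp
    then have "FHom T ?f = g" using Sfaithful[OF _ _ _ Tf g] by blast
    then show ?thesis using f by blast
  qed
  have Tmonic: "monic C (FOb T X) (FOb T Y) (FHom T f)"
    if m: "monic C X Y f" and X: "X \<in> Ob C" and Y: "Y \<in> Ob C" for X Y f
    unfolding monic_def
  proof (intro conjI ballI impI)
    have f: "arr C X Y f" using m X Y by (simp add: monic_def arr_def)
    show "FHom T f \<in> Hom C (FOb T X) (FOb T Y)" using Tarr[OF f] by (simp add: arr_def)
    fix Z u v
    assume Z: "Z \<in> Ob C" and "u \<in> Hom C Z (FOb T X)" "v \<in> Hom C Z (FOb T X)"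
      and eq: "FHom T f \<cdot> u = FHom T f \<cdot> v"
    then have u: "arr C Z (FOb T X) u" and v: "arr C Z (FOb T X) v" using Tob X by (auto simp: arr_def)
    obtain \<epsilon>' where \<epsilon>Z: "arr C (FOb T (FOb S Z)) Z (\<epsilon> Z)" "arr C Z (FOb T (FOb S Z)) \<epsilon>'"
      "\<epsilon> Z \<cdot> \<epsilon>' = Idn C Z"
      using iso_arrow_inverse[OF \<epsilon>[OF Z] Tob[OF Sob[OF Z]] Z] by blast
    \<comment> \<open>every object is the image of one, up to isomorphism, so it is enough to test on images\<close>
    obtain u' where u': "arr C (FOb S Z) X u'" "FHom T u' = u \<cdot> \<epsilon> Z"
      using Tfull[OF arr_comp[OF \<epsilon>Z(1) u] Sob[OF Z] X] by blast
    obtain v' where v': "arr C (FOb S Z) X v'" "FHom T v' = v \<cdot> \<epsilon> Z"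
      using Tfull[OF arr_comp[OF \<epsilon>Z(1) v] Sob[OF Z] X] by blast
    have "FHom T (f \<cdot> u') = FHom T (f \<cdot> v')"
      using Tcomp[OF u'(1) f] Tcomp[OF v'(1) f] u'(2) v'(2) eq
        assoc[OF \<epsilon>Z(1) u Tarr[OF f]] assoc[OF \<epsilon>Z(1) v Tarr[OF f]] by simp
    then have "f \<cdot> u' = f \<cdot> v'"
      using Tfaithful[OF _ _ _ arr_comp[OF u'(1) f] arr_comp[OF v'(1) f]] by blast
    then have "u' = v'" by (rule monic_cancel[OF m _ u'(1) v'(1)])
    then have "(u \<cdot> \<epsilon> Z) \<cdot> \<epsilon>' = (v \<cdot> \<epsilon> Z) \<cdot> \<epsilon>'" using u'(2) v'(2) by simp
    then show "u = v"
      using assoc[OF \<epsilon>Z(2,1) u] assoc[OF \<epsilon>Z(2,1) v] \<epsilon>Z(3) comp_id[OF u] comp_id[OF v] by simp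
  qed
  have Tzero: "FHom T (Zero C X Y) = Zero C (FOb T X) (FOb T Y)"
    if X: "X \<in> Ob C" and Y: "Y \<in> Ob C" for X Y
  proof -
    interpret G: comm_group "hom_grp C X Y" by (rule comm_group_Hom[OF X Y])
    interpret H: comm_group "hom_grp C (FOb T X) (FOb T Y)"
      by (rule comm_group_Hom[OF Tob[OF X] Tob[OF Y]])
    have "FHom T \<in> hom (hom_grp C X Y) (hom_grp C (FOb T X) (FOb T Y))"
      using add X Y by (simp add: additive_functor_def)
    from hom_one[OF this G.is_group H.is_group] show ?thesis by (simp add: hom_grp_def)
  qed
  show ?thesis
  proof (intro full_embedding.intro full_embedding_axioms.intro)
    show "preadditive_category C" by (rule preadditive_category_axioms)
    show "FHom T (Idn C X) = Idn C (FOb T X)" if "X \<in> Ob C" for X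
      using T that by (simp add: endofunctor_def)
    show "f = f'" if "FHom T f = FHom T f'" "arr C X Y f" "arr C X Y f'" for X Y f f'
      using Tfaithful[OF _ _ that] by blast
    show "arr C (FOb T X) (FOb T Y) (FHom T f)" if "arr C X Y f" for X Y f by (rule Tarr[OF that])
    show "FHom T (g \<cdot> f) = FHom T g \<cdot> FHom T f" if "arr C X Y f" "arr C Y Z g" for X Y Z f g
      by (rule Tcomp[OF that])
    show "FHom T (Zero C X Y) = Zero C (FOb T X) (FOb T Y)" if "X \<in> Ob C" "Y \<in> Ob C" for X Y
      by (rule Tzero[OF that])
    show "\<exists>f. arr C X Y f \<and> FHom T f = g"
      if "arr C (FOb T X) (FOb T Y) g" "X \<in> Ob C" "Y \<in> Ob C" for X Y g by (rule Tfull[OF that])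
    show "monic C (FOb T X) (FOb T Y) (FHom T f)"
      if "monic C X Y f" "X \<in> Ob C" "Y \<in> Ob C" for X Y f by (rule Tmonic[OF that])
  qed
qed

lemma full_embedding_iterate:
  assumes "full_embedding C T"
  shows "full_embedding C (iterate_functor T k)"
proof -
  interpret T: full_embedding C T by (rule assms)
  show ?thesis
  proof (induction k)
    case 0
    have "iterate_functor T 0 = id_functor" by (simp add: iterate_functor_def id_functor_def)
    moreover have "full_embedding C id_functor"
    proof (intro full_embedding.intro T.preadditive_category_axioms full_embedding_axioms.intro)
      fix X Y g assume "arr C (FOb id_functor X) (FOb id_functor Y) g"
      then show "\<exists>f. arr C X Y f \<and> FHom id_functor f = g" by (simp add: id_functor_def)
    qed (simp_all add: id_functor_def)
    ultimately show ?case by simp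
  next
    case (Suc k)
    interpret K: full_embedding C "iterate_functor T k" by (rule Suc)
    have [simp]: "FOb (iterate_functor T (Suc k)) X = FOb T (FOb (iterate_functor T k) X)"
      "FHom (iterate_functor T (Suc k)) f = FHom T (FHom (iterate_functor T k) f)" for X f
      by (simp_all add: iterate_functor_def)
    show ?case
    proof (intro full_embedding.intro T.preadditive_category_axioms full_embedding_axioms.intro)
      fix X Y f assume f: "arr C X Y f"
      then show "arr C (FOb (iterate_functor T (Suc k)) X) (FOb (iterate_functor T (Suc k)) Y)
        (FHom (iterate_functor T (Suc k)) f)"
        by (simp add: T.map_arr[OF K.map_arr])
    next
      fix X Y Z f g assume "arr C X Y f" "arr C Y Z g"
      then show "FHom (iterate_functor T (Suc k)) (g \<cdot>\<^bsub>C\<^esub> f)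
        = FHom (iterate_functor T (Suc k)) g \<cdot>\<^bsub>C\<^esub> FHom (iterate_functor T (Suc k)) f"
        using K.map_comp T.map_comp[OF K.map_arr K.map_arr] by simp
    next
      fix X Y g
      assume g: "arr C (FOb (iterate_functor T (Suc k)) X) (FOb (iterate_functor T (Suc k)) Y) g"
        and X: "X \<in> Ob C" and Y: "Y \<in> Ob C"
      then obtain h where "arr C (FOb (iterate_functor T k) X) (FOb (iterate_functor T k) Y) h"
        "FHom T h = g"
        using T.full[OF _ K.map_ob[OF X] K.map_ob[OF Y]] by auto
      then show "\<exists>f. arr C X Y f \<and> FHom (iterate_functor T (Suc k)) f = g"
        using K.full[OF _ X Y] by auto
    next
      fix X Y f f'
      assume "FHom (iterate_functor T (Suc k)) f = FHom (iterate_functor T (Suc k)) f'"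
        and f: "arr C X Y f" and f': "arr C X Y f'"
      then have "FHom (iterate_functor T k) f = FHom (iterate_functor T k) f'"
        using T.faithful[OF _ K.map_arr[OF f] K.map_arr[OF f']] by simp
      then show "f = f'" by (rule K.faithful[OF _ f f'])
    qed (simp_all add: T.map_id K.map_id T.map_zero K.map_zero T.map_monic K.map_monic K.map_ob)
  qed
qed


section \<open>The hard Lefschetz splitting\<close>

context filtered_obj
begin

lemma arrow_power_filtered:
  assumes T: "full_embedding C T" and e: "e \<in> Hom (AF C) V (twist T (translate V 2) 1)"
  shows "arr C (Tot V) (FOb (iterate_functor T k) (Tot V)) (arrow_power C T V e k)"
    and "\<exists>g. arr C (Fil V p) (FOb (iterate_functor T k) (Fil V (p + 2 * int k))) g \<and>
      FHom (iterate_functor T k) (Inc V (p + 2 * int k)) \<cdot> g = arrow_power C T V e k \<cdot> Inc V p"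
proof -
  interpret T: full_embedding C T by (rule T)
  have e_arr: "arr C (Tot V) (FOb T (Tot V)) e"
    using e Tot_ob T.map_ob[OF Tot_ob]
    by (simp add: AF_def twist_def translate_def iterate_functor_def arr_def)
  have e_fil: "\<exists>h. arr C (Fil V p) (FOb T (Fil V (2 + p))) h \<and> FHom T (Inc V (2 + p)) \<cdot> h = e \<cdot> Inc V p"
    for p
    using e Fil_ob T.map_ob[OF Fil_ob]
    by (auto simp: AF_def twist_def translate_def iterate_functor_def arr_def)
  have "arr C (Tot V) (FOb (iterate_functor T k) (Tot V)) (arrow_power C T V e k) \<and>
    (\<exists>g. arr C (Fil V p) (FOb (iterate_functor T k) (Fil V (p + 2 * int k))) g \<and>
      FHom (iterate_functor T k) (Inc V (p + 2 * int k)) \<cdot> g = arrow_power C T V e k \<cdot> Inc V p)"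
  proof (induction k)
    case 0
    show ?case
      using arr_id[OF Tot_ob] arr_id[OF Fil_ob] comp_id[OF Inc_arr] id_comp[OF Inc_arr]
      by (auto simp: iterate_functor_def)
  next
    case (Suc k)
    let ?G = "iterate_functor T k" and ?i = "p + 2 * int k"
    interpret G: full_embedding C ?G by (rule full_embedding_iterate[OF T])
    have Suc_ob: "FOb (iterate_functor T (Suc k)) X = FOb ?G (FOb T X)" for X
      by (simp add: iterate_functor_def funpow_swap1)
    have Suc_hom: "FHom (iterate_functor T (Suc k)) f = FHom ?G (FHom T f)" for f
      by (simp add: iterate_functor_def funpow_swap1)
    have idx: "p + 2 * int (Suc k) = 2 + ?i" by simp
    let ?E = "arrow_power C T V e k"
    obtain g where E: "arr C (Tot V) (FOb ?G (Tot V)) ?E" and g: "arr C (Fil V p) (FOb ?G (Fil V ?i)) g"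
      and Ig: "FHom ?G (Inc V ?i) \<cdot> g = ?E \<cdot> Inc V p"
      using Suc by blast
    obtain h where h: "arr C (Fil V ?i) (FOb T (Fil V (2 + ?i))) h"
      and Ih: "FHom T (Inc V (2 + ?i)) \<cdot> h = e \<cdot> Inc V ?i"
      using e_fil by blast
    note Gh = G.map_arr[OF h] and Ge = G.map_arr[OF e_arr] and TI = T.map_arr[OF Inc_arr]
    have "FHom ?G (FHom T (Inc V (2 + ?i))) \<cdot> (FHom ?G h \<cdot> g)
        = FHom ?G (FHom T (Inc V (2 + ?i)) \<cdot> h) \<cdot> g"
      by (simp add: assoc[OF g Gh G.map_arr[OF TI], symmetric] G.map_comp[OF h TI])
    also have "\<dots> = FHom ?G e \<cdot> (FHom ?G (Inc V ?i) \<cdot> g)"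
      by (simp add: Ih G.map_comp[OF Inc_arr e_arr] assoc[OF g G.map_arr[OF Inc_arr] Ge])
    also have "\<dots> = (FHom ?G e \<cdot> ?E) \<cdot> Inc V p"
      by (simp add: Ig assoc[OF Inc_arr E Ge])
    finally show ?case
      unfolding Suc_ob Suc_hom idx arrow_power.simps
      using arr_comp[OF E Ge] arr_comp[OF g Gh] by blast
  qed
  then show "arr C (Tot V) (FOb (iterate_functor T k) (Tot V)) (arrow_power C T V e k)"
    and "\<exists>g. arr C (Fil V p) (FOb (iterate_functor T k) (Fil V (p + 2 * int k))) g \<and>
      FHom (iterate_functor T k) (Inc V (p + 2 * int k)) \<cdot> g = arrow_power C T V e k \<cdot> Inc V p"
    by blast+
qed

text \<open>
  The induced arrow is defined by a description; it exists because the restriction \<open>f\<close> of \<open>e\<^sup>k\<close> to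
  \<open>Fil V p\<close> carries \<open>Fil V (p - 1)\<close> into the shift of \<open>Fil V (p + 2k - 1)\<close>, which the shifted quotient
  arrow kills.
\<close>

lemma gr_power_induced:
  assumes T: "full_embedding C T" and e: "e \<in> Hom (AF C) V (twist T (translate V 2) 1)"
  obtains f where "arr C (Fil V p) (FOb (iterate_functor T k) (Fil V (p + 2 * int k))) f"
    and "FHom (iterate_functor T k) (Inc V (p + 2 * int k)) \<cdot> f = arrow_power C T V e k \<cdot> Inc V p"
    and "gr_power C T V e k p \<cdot> gr_proj C V p
      = FHom (iterate_functor T k) (gr_proj C V (p + 2 * int k)) \<cdot> f"
proof -
  let ?G = "iterate_functor T k" and ?E = "arrow_power C T V e k" and ?i = "p + 2 * int k"
  interpret G: full_embedding C ?G by (rule full_embedding_iterate[OF T])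
  note E = arrow_power_filtered(1)[OF T e, of k]
  obtain f where f: "arr C (Fil V p) (FOb ?G (Fil V ?i)) f" and If: "FHom ?G (Inc V ?i) \<cdot> f = ?E \<cdot> Inc V p"
    using arrow_power_filtered(2)[OF T e] by blast
  have idx: "p - 1 + 2 * int k = ?i - 1" by simp
  obtain f' where f': "arr C (Fil V (p - 1)) (FOb ?G (Fil V (?i - 1))) f'"
    and If': "FHom ?G (Inc V (?i - 1)) \<cdot> f' = ?E \<cdot> Inc V (p - 1)"
    using arrow_power_filtered(2)[OF T e, of "p - 1" k] unfolding idx by blast
  note GI = G.map_arr[OF Inc_arr] and Gs = G.map_arr[OF step_arr] and Gq = G.map_arr[OF proj_arr]
  have "FHom ?G (Inc V ?i) \<cdot> (f \<cdot> step C V p) = ?E \<cdot> (Inc V p \<cdot> step C V p)"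
    by (simp add: assoc[OF step_arr f GI, symmetric] If assoc[OF step_arr Inc_arr E])
  also have "\<dots> = FHom ?G (Inc V ?i \<cdot> step C V ?i) \<cdot> f'" by (simp add: Inc_step If')
  also have "\<dots> = FHom ?G (Inc V ?i) \<cdot> (FHom ?G (step C V ?i) \<cdot> f')"
    by (simp add: G.map_comp[OF step_arr Inc_arr] assoc[OF f' Gs GI])
  finally have fs: "f \<cdot> step C V p = FHom ?G (step C V ?i) \<cdot> f'"
    by (rule monic_cancel[OF G.map_monic[OF Inc_monic Fil_ob Tot_ob] _
          arr_comp[OF step_arr f] arr_comp[OF f' Gs]])
  have restr: "restr C V (twist T (translate V (2 * int k)) k) ?E p = f"
    using G.map_monic[OF Inc_monic Fil_ob Tot_ob] f If
    by (intro restr_eq) (simp_all add: twist_def translate_def add.commute)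
  let ?h = "FHom ?G (gr_proj C V ?i) \<cdot> f"
  have h: "arr C (Fil V p) (FOb ?G (gr C V ?i)) ?h" by (rule arr_comp[OF f Gq])
  have "?h \<cdot> step C V p = FHom ?G (gr_proj C V ?i \<cdot> step C V ?i) \<cdot> f'"
    by (simp add: assoc[OF step_arr f Gq] fs assoc[OF f' Gs Gq, symmetric] G.map_comp[OF step_arr proj_arr])
  also have "\<dots> = Zero C (Fil V (p - 1)) (FOb ?G (gr C V ?i))"
    by (simp add: proj_step G.map_zero[OF Fil_ob gr_ob] zero_comp[OF f' G.map_ob[OF gr_ob]])
  finally obtain c where c: "arr C (gr C V p) (FOb ?G (gr C V ?i)) c" "c \<cdot> gr_proj C V p = ?h"
    using proj_factor[OF h] by blast
  have "gr_power C T V e k p = c"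
    unfolding gr_power_def descend_def restr
  proof (rule the_equality)
    fix c' assume c': "c' \<in> Hom C (gr C V p) (FOb ?G (gr C V ?i)) \<and> c' \<cdot> gr_proj C V p = ?h"
    moreover from this have "arr C (gr C V p) (FOb ?G (gr C V ?i)) c'"
      using gr_ob G.map_ob[OF gr_ob] by (simp add: arr_def)
    ultimately show "c' = c" using c by (intro proj_cancel[OF _ _ c(1)]) simp_all
  qed (use c in \<open>simp add: arr_def\<close>)
  then show thesis using that[OF f If] c(2) by simp
qed

text \<open>
  One step of the induction that splits the filtration from both ends towards the middle, used with
  \<open>a = - k\<close>, \<open>b = k\<close>, \<open>E = e\<^sup>k\<close> and \<open>G = (k)\<close>; here \<open>\<rho>\<close> retracts \<open>V\<close> onto \<open>Fil V (a - 1)\<close> and \<open>\<sigma>\<close>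
  retracts \<open>V\<close> onto \<open>Fil V b\<close>. The isomorphism \<open>c\<close> transports a splitting of the lower graded piece
  to the upper one, and in return a shifted projection of \<open>V\<close> onto the upper piece, composed with
  \<open>E\<close>, extends the quotient arrow of \<open>Fil V a\<close> to all of \<open>V\<close>.
\<close>

lemma lefschetz_step:
  assumes G: "full_embedding C G"
    and E: "arr C (Tot V) (FOb G (Tot V)) E"
    and f: "arr C (Fil V a) (FOb G (Fil V b)) f" and If: "FHom G (Inc V b) \<cdot> f = E \<cdot> Inc V a"
    and iso: "iso_arrow C (gr C V a) (FOb G (gr C V b)) c"
    and cq: "c \<cdot> gr_proj C V a = FHom G (gr_proj C V b) \<cdot> f"
    and \<rho>: "arr C (Tot V) (Fil V (a - 1)) \<rho>" and \<rho>I: "\<rho> \<cdot> Inc V (a - 1) = Idn C (Fil V (a - 1))"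
    and \<sigma>: "arr C (Tot V) (Fil V b) \<sigma>" and \<sigma>I: "\<sigma> \<cdot> Inc V b = Idn C (Fil V b)"
  shows "\<exists>s. arr C (gr C V a) (Fil V a) s \<and> gr_proj C V a \<cdot> s = Idn C (gr C V a)"
    and "\<exists>s. arr C (gr C V b) (Fil V b) s \<and> gr_proj C V b \<cdot> s = Idn C (gr C V b)"
    and "\<exists>\<rho>'. arr C (Tot V) (Fil V a) \<rho>' \<and> \<rho>' \<cdot> Inc V a = Idn C (Fil V a)"
    and "\<exists>\<sigma>'. arr C (Tot V) (Fil V (b - 1)) \<sigma>' \<and> \<sigma>' \<cdot> Inc V (b - 1) = Idn C (Fil V (b - 1))"
proof -
  interpret G: full_embedding C G by (rule G)
  obtain d where c: "arr C (gr C V a) (FOb G (gr C V b)) c" and d: "arr C (FOb G (gr C V b)) (gr C V a) d"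
    and dc: "d \<cdot> c = Idn C (gr C V a)" and cd: "c \<cdot> d = Idn C (FOb G (gr C V b))"
    using iso_arrow_inverse[OF iso gr_ob G.map_ob[OF gr_ob]] by blast
  note Gq = G.map_arr[OF proj_arr] and GI = G.map_arr[OF Inc_arr] and G\<sigma> = G.map_arr[OF \<sigma>]
  \<comment> \<open>restricting \<open>\<rho>\<close> to \<open>Fil V a\<close> splits the lower graded piece\<close>
  let ?t = "\<rho> \<cdot> Inc V a"
  have t: "arr C (Fil V a) (Fil V (a - 1)) ?t" by (rule arr_comp[OF Inc_arr \<rho>])
  have "?t \<cdot> step C V a = Idn C (Fil V (a - 1))"
    by (simp add: assoc[OF step_arr Inc_arr \<rho>] Inc_step \<rho>I)
  from section_of_retraction[OF t this]
  obtain s where s: "arr C (gr C V a) (Fil V a) s" and qs: "gr_proj C V a \<cdot> s = Idn C (gr C V a)"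
    and st: "Add C (s \<cdot> gr_proj C V a) (step C V a \<cdot> ?t) = Idn C (Fil V a)" .
  then show "\<exists>s. arr C (gr C V a) (Fil V a) s \<and> gr_proj C V a \<cdot> s = Idn C (gr C V a)" by blast
  \<comment> \<open>carrying \<open>s\<close> over along \<open>f\<close> gives a section of the shifted upper quotient arrow; by fullness it
    is a shift, and by faithfulness it is the shift of a section\<close>
  let ?u = "f \<cdot> (s \<cdot> d)"
  have sd: "arr C (FOb G (gr C V b)) (Fil V a) (s \<cdot> d)" by (rule arr_comp[OF d s])
  have u: "arr C (FOb G (gr C V b)) (FOb G (Fil V b)) ?u" by (rule arr_comp[OF sd f])
  have "FHom G (gr_proj C V b) \<cdot> ?u = (c \<cdot> gr_proj C V a) \<cdot> (s \<cdot> d)"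
    by (simp add: assoc[OF sd f Gq, symmetric] cq)
  also have "\<dots> = c \<cdot> ((gr_proj C V a \<cdot> s) \<cdot> d)"
    by (simp add: assoc[OF sd proj_arr c] assoc[OF d s proj_arr])
  also have "\<dots> = FHom G (Idn C (gr C V b))" by (simp add: qs id_comp[OF d] cd G.map_id[OF gr_ob])
  finally have Gqu: "FHom G (gr_proj C V b) \<cdot> ?u = FHom G (Idn C (gr C V b))" .
  obtain w where w: "arr C (gr C V b) (Fil V b) w" and Gw: "FHom G w = ?u"
    using G.full[OF u gr_ob Fil_ob] by blast
  have qw: "gr_proj C V b \<cdot> w = Idn C (gr C V b)"
    by (rule G.faithful[OF _ arr_comp[OF w proj_arr] arr_id[OF gr_ob]])
      (simp add: G.map_comp[OF w proj_arr] Gw Gqu)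
  then show "\<exists>s. arr C (gr C V b) (Fil V b) s \<and> gr_proj C V b \<cdot> s = Idn C (gr C V b)" using w by blast
  \<comment> \<open>\<open>?d\<close> extends the lower quotient arrow to \<open>V\<close>: on \<open>Fil V a\<close> the arrow \<open>E\<close> takes values in the shift
    of \<open>Fil V b\<close>, where \<open>\<sigma>\<close> has no effect\<close>
  let ?g = "FHom G \<sigma> \<cdot> E"
  let ?d = "d \<cdot> (FHom G (gr_proj C V b) \<cdot> ?g)"
  have g: "arr C (Tot V) (FOb G (Fil V b)) ?g" by (rule arr_comp[OF E G\<sigma>])
  have qg: "arr C (Tot V) (FOb G (gr C V b)) (FHom G (gr_proj C V b) \<cdot> ?g)" by (rule arr_comp[OF g Gq])
  have D: "arr C (Tot V) (gr C V a) ?d" by (rule arr_comp[OF qg d])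
  have "?g \<cdot> Inc V a = (FHom G \<sigma> \<cdot> FHom G (Inc V b)) \<cdot> f"
    by (simp add: assoc[OF Inc_arr E G\<sigma>] If[symmetric] assoc[OF f GI G\<sigma>])
  also have "\<dots> = f" by (simp add: G.map_comp[OF Inc_arr \<sigma>, symmetric] \<sigma>I G.map_id[OF Fil_ob] id_comp[OF f])
  finally have gI: "?g \<cdot> Inc V a = f" .
  have "?d \<cdot> Inc V a = d \<cdot> (c \<cdot> gr_proj C V a)"
    by (simp add: assoc[OF Inc_arr qg d] assoc[OF Inc_arr g Gq] gI cq)
  also have "\<dots> = gr_proj C V a"
    by (simp add: assoc[OF proj_arr c d, symmetric] dc id_comp[OF proj_arr])
  finally have DI: "?d \<cdot> Inc V a = gr_proj C V a" .
  have sD: "arr C (Tot V) (Fil V a) (s \<cdot> ?d)" by (rule arr_comp[OF D s])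
  have j\<rho>: "arr C (Tot V) (Fil V a) (step C V a \<cdot> \<rho>)" by (rule arr_comp[OF \<rho> step_arr])
  \<comment> \<open>on \<open>Fil V a\<close> this sum is the decomposition of the identity that defines \<open>s\<close>\<close>
  have "Add C (s \<cdot> ?d) (step C V a \<cdot> \<rho>) \<cdot> Inc V a = Idn C (Fil V a)"
    by (simp add: add_comp[OF Inc_arr sD j\<rho>] assoc[OF Inc_arr D s] DI assoc[OF Inc_arr \<rho> step_arr] st)
  then show "\<exists>\<rho>'. arr C (Tot V) (Fil V a) \<rho>' \<and> \<rho>' \<cdot> Inc V a = Idn C (Fil V a)"
    using arr_add[OF sD j\<rho>] by blast
  obtain \<tau> where \<tau>: "arr C (Fil V b) (Fil V (b - 1)) \<tau>" and \<tau>j: "\<tau> \<cdot> step C V b = Idn C (Fil V (b - 1))"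
    using retraction_of_section[OF w qw] by blast
  have "(\<tau> \<cdot> \<sigma>) \<cdot> Inc V (b - 1) = \<tau> \<cdot> (\<sigma> \<cdot> (Inc V b \<cdot> step C V b))"
    by (simp add: assoc[OF Inc_arr \<sigma> \<tau>] Inc_step)
  also have "\<dots> = Idn C (Fil V (b - 1))"
    by (simp add: assoc[OF step_arr Inc_arr \<sigma>, symmetric] \<sigma>I id_comp[OF step_arr] \<tau>j)
  finally show "\<exists>\<sigma>'. arr C (Tot V) (Fil V (b - 1)) \<sigma>' \<and> \<sigma>' \<cdot> Inc V (b - 1) = Idn C (Fil V (b - 1))"
    using arr_comp[OF \<sigma> \<tau>] by blast
qed

text \<open>
  Descending induction on \<open>k\<close>: \<open>V\<close> retracts onto \<open>Fil V (- k - 1)\<close> and onto \<open>Fil V k\<close>. For large \<open>k\<close>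
  these are zero and all of \<open>V\<close>. Each step also splits the graded pieces of index \<open>- k\<close> and \<open>k\<close>.
\<close>

lemma lefschetz_sections:
  assumes T: "full_embedding C T" and e: "e \<in> Hom (AF C) V (twist T (translate V 2) 1)"
    and iso: "\<And>k :: nat. iso_arrow C (gr C V (- int k)) (FOb (iterate_functor T k) (gr C V (int k)))
      (gr_power C T V e k (- int k))"
  shows "\<exists>s. arr C (gr C V p) (Fil V p) s \<and> gr_proj C V p \<cdot> s = Idn C (gr C V p)"
proof -
  define retracts where "retracts p \<longleftrightarrow> (\<exists>\<rho>. arr C (Tot V) (Fil V p) \<rho> \<and> \<rho> \<cdot> Inc V p = Idn C (Fil V p))" for p
  define sections where "sections p \<longleftrightarrow>
    (\<exists>s. arr C (gr C V p) (Fil V p) s \<and> gr_proj C V p \<cdot> s = Idn C (gr C V p))" for p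
  have lefschetz: "sections (- int k) \<and> sections (int k) \<and> retracts (- int k) \<and> retracts (int k - 1)"
    if r: "retracts (- int k - 1)" "retracts (int k)" for k
  proof -
    let ?G = "iterate_functor T k"
    have idx: "- int k + 2 * int k = int k" by simp
    obtain f where f: "arr C (Fil V (- int k)) (FOb ?G (Fil V (int k))) f"
      "FHom ?G (Inc V (int k)) \<cdot> f = arrow_power C T V e k \<cdot> Inc V (- int k)"
      "gr_power C T V e k (- int k) \<cdot> gr_proj C V (- int k) = FHom ?G (gr_proj C V (int k)) \<cdot> f"
      using gr_power_induced[OF T e, of "- int k" k] unfolding idx by blast
    obtain \<rho> \<sigma> where "arr C (Tot V) (Fil V (- int k - 1)) \<rho>" "\<rho> \<cdot> Inc V (- int k - 1) = Idn C (Fil V (- int k - 1))"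
      "arr C (Tot V) (Fil V (int k)) \<sigma>" "\<sigma> \<cdot> Inc V (int k) = Idn C (Fil V (int k))"
      using r unfolding retracts_def by blast
    note * = lefschetz_step[OF full_embedding_iterate[OF T] arrow_power_filtered(1)[OF T e] f(1,2) iso f(3) this]
    show ?thesis unfolding sections_def retracts_def by (intro conjI *)
  qed
  have bounds: "retracts (- int k - 1) \<and> retracts (int k)" for k
  proof -
    obtain N where top: "\<And>p. int N \<le> p \<Longrightarrow> iso_arrow C (Fil V p) (Tot V) (Inc V p)"
      and bot: "\<And>p. p \<le> - int N \<Longrightarrow> zero_object C (Fil V p)" and kN: "k \<le> N"
      using filtration_bound by blast
    show ?thesis
      using kN
    proof (induction k rule: inc_induct)
      case base
      have z: "zero_object C (Fil V (- int N - 1))" by (rule bot) simp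
      have \<rho>: "arr C (Tot V) (Fil V (- int N - 1)) (Zero C (Tot V) (Fil V (- int N - 1)))"
        by (rule arr_zero[OF Tot_ob Fil_ob])
      have "Zero C (Tot V) (Fil V (- int N - 1)) \<cdot> Inc V (- int N - 1) = Idn C (Fil V (- int N - 1))"
        using to_zero_object[OF arr_comp[OF Inc_arr \<rho>] z] to_zero_object[OF arr_id[OF Fil_ob] z] by simp
      then have "retracts (- int N - 1)" using \<rho> unfolding retracts_def by blast
      moreover have "retracts (int N)"
        using iso_arrow_inverse[OF top[of "int N"] Fil_ob Tot_ob] unfolding retracts_def by blast
      ultimately show ?case by simp
    next
      case (step k)
      have idx: "- int (Suc k) = - int k - 1" "int (Suc k) - 1 = int k" by simp_all
      show ?case using lefschetz[of "Suc k"] step.IH unfolding idx by blast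
    qed
  qed
  have "sections p"
  proof (cases "0 \<le> p")
    case True
    then show ?thesis using lefschetz[of "nat p"] bounds[of "nat p"] by simp
  next
    case False
    then show ?thesis using lefschetz[of "nat (- p)"] bounds[of "nat (- p)"] by simp
  qed
  then show ?thesis unfolding sections_def .
qed

end

theorem proposition2p3p2:
  fixes A :: "('o, 'm) cat" and T :: "('o, 'm) functor_data"
    and V :: "('o, 'm) filtered" and e :: 'm and r :: int
  assumes "abelian_category A"
    and "shift_functor A T"
    and "V \<in> Ob (AF A)"
    and "0 \<le> r"
    and "has_type A V (- r) r"
    and "e \<in> Hom (AF A) V (twist T (translate V 2) 1)"
    and "\<And>k :: nat. iso_arrow A (gr A V (- int k)) (FOb (iterate_functor T k) (gr A V (int k)))
      (gr_power A T V e k (- int k))"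
  shows "(\<exists>W \<iota> \<pi>. is_graded_sum A V (- r) r W \<iota> \<pi>) \<and>
    (\<forall>W \<iota> \<pi>. is_graded_sum A V (- r) r W \<iota> \<pi> \<longrightarrow>
      (\<exists>\<phi>. good_splitting A V (- r) r W \<pi> \<phi>))"
proof -
  interpret A: abelian_category A by (rule assms(1))
  interpret V: filtered_obj A V using assms(3) by (intro A.filtered_objI) simp
  have "\<forall>p. \<exists>s. arr A (gr A V p) (Fil V p) s \<and> gr_proj A V p \<cdot>\<^bsub>A\<^esub> s = Idn A (gr A V p)"
    using V.lefschetz_sections[OF A.full_embedding_shift[OF assms(2)] assms(6,7)] by blast
  then obtain s where s: "\<And>p. arr A (gr A V p) (Fil V p) (s p)"
    "\<And>p. gr_proj A V p \<cdot>\<^bsub>A\<^esub> s p = Idn A (gr A V p)"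
    by metis
  obtain \<iota>' \<pi>' where ds: "is_graded_sum A V (- r) r V \<iota>' \<pi>'"
    and \<pi>': "\<And>p. p \<in> {- r..r} \<Longrightarrow> \<pi>' p \<cdot>\<^bsub>A\<^esub> Inc V p = gr_proj A V p"
    using V.graded_sum_of_sections[OF s assms(5)] by blast
  show ?thesis using ds V.good_splitting_of_graded_sums[OF _ ds \<pi>'] by blast
qed

end
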